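(* There exists a (randomized) algorithm for the graphic matroid secretary problem that is $3.95$-competitive on the family of all finite loopless multigraphs with nonnegative edge weights. That is, for every such weighted multigraph $G$, the algorithm outputs an acyclic set of edges $A$ with $3.95\cdot\mathbb{E}[w(A)]\ge OPT(G)$.
   Context: Graphic matroid secretary problem: the input is a finite undirected multigraph $G=(V,E)$ without loops (parallel edges allowed), with $|V|=n$, $|E|=m$ and edge weights $w:E\to\mathbb{R}_{\ge 0}$. The algorithm knows $V$ and $m$ in advance. The edges of $E$ arrive one at a time in an order chosen uniformly at random among all orderings of $E$; when an edge arrives the algorithm learns its endpoints and its weight and must immediately and irrevocably accept or reject it, subject to the constraint that the set of accepted edges is always acyclic (a forest; in a multigraph two parallel edges form a cycle). The algorithm may use internal randomness. $ALG$ denotes the total weight of accepted edges and $OPT(G)$ the maximum weight of an acyclic edge set of $G$. An algorithm is $\alpha$-competitive ($\alpha\ge 1$) on a family of weighted graphs if $\alpha\cdot\mathbb{E}[ALG]\ge OPT(G)$ for every graph in the family, the expectation being over the random arrival order and the algorithm's randomness. *)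

theory Defs
  imports "HOL-Probability.Probability" "HOL-Combinatorics.Multiset_Permutations"
begin

(* A weighted loopless multigraph with vertex set V (finite set of nat labels) and
   m edges named 0..<m. Edge i has endpoint set ends i (a 2-element subset of V,
   so loops are excluded; parallel edges allowed) and weight w i >= 0. *)
definition graph_input ::
  "nat set \<Rightarrow> nat \<Rightarrow> (nat \<Rightarrow> nat set) \<Rightarrow> (nat \<Rightarrow> real) \<Rightarrow> bool" where
  "graph_input V m ends w \<longleftrightarrow> finite V \<and>
     (\<forall>i<m. ends i \<subseteq> V \<and> card (ends i) = 2 \<and> w i \<ge> 0)"

definition is_cycle :: "(nat \<Rightarrow> nat set) \<Rightarrow> nat list \<Rightarrow> nat list \<Rightarrow> bool" where
  "is_cycle ends es vs \<longleftrightarrow> length es \<ge> 1 \<and> length vs = length es \<and>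
     distinct es \<and> distinct vs \<and>
     (\<forall>i<length es. ends (es ! i) = {vs ! i, vs ! ((i + 1) mod length es)})"

definition acyclic_edges :: "(nat \<Rightarrow> nat set) \<Rightarrow> nat set \<Rightarrow> bool" where
  "acyclic_edges ends F \<longleftrightarrow> \<not> (\<exists>es vs. set es \<subseteq> F \<and> is_cycle ends es vs)"

definition OPT :: "nat \<Rightarrow> (nat \<Rightarrow> nat set) \<Rightarrow> (nat \<Rightarrow> real) \<Rightarrow> real" where
  "OPT m ends w = Max ((\<lambda>F. \<Sum>i\<in>F. w i) ` {F. F \<subseteq> {0..<m} \<and> acyclic_edges ends F})"

(* A deterministic online strategy: given the observations (endpoint set, weight)
   of the edges arrived so far, the last one being the current edge, decide
   whether to accept the current edge. *)
type_synonym strategy = "(nat set \<times> real) list \<Rightarrow> bool"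

definition observations ::
  "(nat \<Rightarrow> nat set) \<Rightarrow> (nat \<Rightarrow> real) \<Rightarrow> nat list \<Rightarrow> (nat set \<times> real) list" where
  "observations ends w xs = map (\<lambda>e. (ends e, w e)) xs"

definition accepted ::
  "strategy \<Rightarrow> (nat \<Rightarrow> nat set) \<Rightarrow> (nat \<Rightarrow> real) \<Rightarrow> nat list \<Rightarrow> nat set" where
  "accepted s ends w xs =
     {xs ! k | k. k < length xs \<and> s (take (Suc k) (observations ends w xs))}"

(* A randomized algorithm: given V and m, a probability distribution over
   deterministic strategies. *)
type_synonym algorithm = "nat set \<Rightarrow> nat \<Rightarrow> strategy pmf"

definition feasible :: "algorithm \<Rightarrow> bool" where
  "feasible alg \<longleftrightarrow> (\<forall>V m ends w. graph_input V m ends w \<longrightarrow>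
     (\<forall>s\<in>set_pmf (alg V m). \<forall>xs\<in>permutations_of_set {0..<m}.
        acyclic_edges ends (accepted s ends w xs)))"

definition expected_ALG ::
  "algorithm \<Rightarrow> nat set \<Rightarrow> nat \<Rightarrow> (nat \<Rightarrow> nat set) \<Rightarrow> (nat \<Rightarrow> real) \<Rightarrow> real" where
  "expected_ALG alg V m ends w =
     measure_pmf.expectation (alg V m)
       (\<lambda>s. measure_pmf.expectation (pmf_of_set (permutations_of_set {0..<m}))
              (\<lambda>xs. \<Sum>i\<in>accepted s ends w xs. w i))"

end

(*
  Sample each edge with probability 1/2, as a prefix of the arrival order, and keep this sample S
  fixed. Run Prim's algorithm on S. An edge h outside S hits the vertex y if Prim's run on S + h
  enters y through h; its other end is then visited before y already in the run on S. Accept h if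
  it hits a vertex that no earlier edge outside the sample has hit. Accepted edges point forward in
  the visiting order of S and have distinct heads, so they contain no cycle.

  Let e = {u, v} lie in the maximum spanning forest of the whole graph, and let it arrive at time
  t (times being uniform in [0, 1]), so that each edge that came before belongs to the sample with
  probability q = 1/(2t). If Prim's run reaches u before v, then e hits v. The edge through which
  the run enters {u, v} is the best one in a ranking of the edges at u and v that depends only on
  the other sampled edges; given this, the edge through which v would be entered without e is the
  best one of a second ranking, and v has not been hit if this edge is in the sample. If both best
  edges are sampled, which has probability q^2, then e is accepted. There is a gain over q^2, hence
  over the competitive ratio 4, because the second best edge of the first ranking will also do if
  it enters at the same end as the best one; among the top three edges two share an end, so this
  happens with probability at least t^2 (1 - t). Altogether e is accepted with probability at least
  the integral of q^2 (1 + q' t^2 (1 - t)), q' = 1 - q, over t from 1/2 to 1, that is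
  11/32 - (ln 2)/8 > 1/3.95.
*)

theory Submission
  imports Defs
begin

section \<open>Prim's algorithm on a subset of the edges\<close>

locale prim =
  fixes V :: "nat set" and E :: "'e set" and ends :: "'e \<Rightarrow> nat set"
    and better :: "'e \<Rightarrow> 'e \<Rightarrow> bool" (infix "\<succ>" 50)
  assumes finite_V: "finite V"
    and finite_E: "finite E"
    and ends_subset: "g \<in> E \<Longrightarrow> ends g \<subseteq> V"
    and card_ends: "g \<in> E \<Longrightarrow> card (ends g) = 2"
    and better_irrefl: "\<not> g \<succ> g"
    and better_trans: "g \<succ> h \<Longrightarrow> h \<succ> k \<Longrightarrow> g \<succ> k"
    and better_total: "g \<in> E \<Longrightarrow> h \<in> E \<Longrightarrow> g \<noteq> h \<Longrightarrow> g \<succ> h \<or> h \<succ> g"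
begin

definition leaving :: "'e set \<Rightarrow> nat set \<Rightarrow> 'e set" where
  "leaving S W = {g \<in> S. ends g \<inter> W \<noteq> {} \<and> \<not> ends g \<subseteq> W}"

definition pick :: "'e set \<Rightarrow> nat set \<Rightarrow> 'e option" where
  "pick S W = (if leaving S W = {} then None
     else Some (SOME g. g \<in> leaving S W \<and> (\<forall>h\<in>leaving S W. h \<noteq> g \<longrightarrow> g \<succ> h)))"

text \<open>If no edge leaves \<open>W\<close>, the run jumps to the smallest unvisited vertex. In particular it
  starts at the smallest vertex and ends up visiting all of \<open>V\<close>.\<close>

definition next_vertex :: "'e set \<Rightarrow> nat set \<Rightarrow> nat" where
  "next_vertex S W = (case pick S W of None \<Rightarrow> Min (V - W) | Some g \<Rightarrow> the_elem (ends g - W))"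

primrec visited :: "'e set \<Rightarrow> nat \<Rightarrow> nat set" where
  "visited S 0 = {}"
| "visited S (Suc k) = insert (next_vertex S (visited S k)) (visited S k)"

definition hit_step :: "nat set \<Rightarrow> 'e set \<Rightarrow> nat" where
  "hit_step U S = (LEAST k. next_vertex S (visited S k) \<in> U)"

text \<open>\<open>None\<close> means that the run gets into \<open>U\<close> by a jump. Such an
  entry asks for no sampled edge, so it counts as a favourable case in all later bounds.\<close>

definition hit_edge :: "nat set \<Rightarrow> 'e set \<Rightarrow> 'e option" where
  "hit_edge U S = pick S (visited S (hit_step U S))"

definition first_hit :: "nat set \<Rightarrow> 'e set \<Rightarrow> nat" where
  "first_hit U S = next_vertex S (visited S (hit_step U S))"

text \<open>The test run has \<open>h\<close> on top of the sample \<open>S\<close> but no other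
  unsampled edge, so hitting does not depend on the remaining arrivals outside the sample.\<close>

definition hits :: "'e set \<Rightarrow> 'e \<Rightarrow> nat \<Rightarrow> bool" where
  "hits S h y \<longleftrightarrow> y \<in> V \<and> hit_edge {y} (insert h S) = Some h"

section \<open>The best edge of a cut\<close>

lemma finite_best:
  assumes "finite L" "L \<noteq> {}" "L \<subseteq> E"
  shows "\<exists>g\<in>L. \<forall>h\<in>L. h \<noteq> g \<longrightarrow> g \<succ> h"
  using assms
proof (induction L rule: finite_ne_induct)
  case (insert x F)
  then obtain g where g: "g \<in> F" "\<forall>h\<in>F. h \<noteq> g \<longrightarrow> g \<succ> h" by auto
  have "g \<noteq> x" "x \<in> E" "g \<in> E" using g insert by auto
  then consider "g \<succ> x" | "x \<succ> g" using better_total by blast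
  then show ?case
  proof cases
    case 1
    then show ?thesis using g by auto
  next
    case 2
    have "x \<succ> h" if "h \<in> F" for h
      using g(2) that 2 better_trans[OF 2, of h] by (cases "h = g") auto
    then show ?thesis by auto
  qed
qed auto

lemma finite_sub: "S \<subseteq> E \<Longrightarrow> finite S"
  using finite_E finite_subset by blast

lemma leaving_subset: "leaving S W \<subseteq> S"
  by (auto simp: leaving_def)

lemma pick_None_iff: "pick S W = None \<longleftrightarrow> leaving S W = {}"
  by (auto simp: pick_def)

lemma pick_SomeD:
  assumes "S \<subseteq> E" "pick S W = Some g"
  shows "g \<in> leaving S W" "\<And>h. h \<in> leaving S W \<Longrightarrow> h \<noteq> g \<Longrightarrow> g \<succ> h"
proof -
  have ne: "leaving S W \<noteq> {}"
    and g: "g = (SOME g. g \<in> leaving S W \<and> (\<forall>h\<in>leaving S W. h \<noteq> g \<longrightarrow> g \<succ> h))"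
    using assms(2) by (auto simp: pick_def split: if_splits)
  have "\<exists>g. g \<in> leaving S W \<and> (\<forall>h\<in>leaving S W. h \<noteq> g \<longrightarrow> g \<succ> h)"
    using finite_best[OF finite_subset[OF leaving_subset finite_sub[OF assms(1)]] ne
        subset_trans[OF leaving_subset assms(1)]] by blast
  then have "g \<in> leaving S W \<and> (\<forall>h\<in>leaving S W. h \<noteq> g \<longrightarrow> g \<succ> h)"
    unfolding g by (rule someI_ex)
  then show "g \<in> leaving S W" "\<And>h. h \<in> leaving S W \<Longrightarrow> h \<noteq> g \<Longrightarrow> g \<succ> h" by auto
qed

lemma pick_eqI:
  assumes "S \<subseteq> E" "g \<in> leaving S W" "\<And>h. h \<in> leaving S W \<Longrightarrow> h \<noteq> g \<Longrightarrow> g \<succ> h"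
  shows "pick S W = Some g"
proof -
  obtain g' where g': "pick S W = Some g'"
    using assms(2) pick_None_iff[of S W] by (cases "pick S W") auto
  have "g' = g"
  proof (rule ccontr)
    assume ne: "g' \<noteq> g"
    have "g' \<succ> g" by (rule pick_SomeD(2)[OF assms(1) g' assms(2)]) (use ne in simp)
    moreover have "g \<succ> g'" by (rule assms(3)[OF pick_SomeD(1)[OF assms(1) g'] ne])
    ultimately show False using better_trans better_irrefl by blast
  qed
  then show ?thesis using g' by simp
qed

text \<open>A maximum stays the maximum when other candidates disappear, and an empty cut stays
  empty. All comparisons of two runs rest on this.\<close>

lemma pick_remove:
  assumes S: "S \<subseteq> E" "S' \<subseteq> S" and g: "\<And>g. pick S W = Some g \<Longrightarrow> g \<in> S'"
  shows "pick S' W = pick S W"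
proof -
  have sub: "leaving S' W = leaving S W \<inter> S'"
    using S(2) by (auto simp: leaving_def)
  show ?thesis
  proof (cases "pick S W")
    case None
    then have "leaving S' W = {}" unfolding pick_None_iff sub by simp
    then have "pick S' W = None" unfolding pick_None_iff .
    then show ?thesis unfolding None .
  next
    case (Some g)
    have "pick S' W = Some g"
    proof (rule pick_eqI)
      show "S' \<subseteq> E" using S by blast
      show "g \<in> leaving S' W" unfolding sub using pick_SomeD(1)[OF S(1) Some] assms(3)[OF Some] by blast
      fix h assume "h \<in> leaving S' W" "h \<noteq> g"
      then show "g \<succ> h" unfolding sub using pick_SomeD(2)[OF S(1) Some, of h] by blast
    qed
    then show ?thesis using Some by simp
  qed
qed

lemma ends_pair:
  assumes "g \<in> E" obtains x y where "ends g = {x, y}" "x \<noteq> y" "x \<in> V" "y \<in> V"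
  using card_ends[OF assms] ends_subset[OF assms] by (auto simp: card_2_iff)

lemma leaving_ends:
  assumes "S \<subseteq> E" "pick S W = Some g"
  obtains a where "ends g = {a, next_vertex S W}" "a \<in> W" "next_vertex S W \<notin> W" "next_vertex S W \<in> V" "a \<in> V" "g \<in> S"
proof -
  have g: "g \<in> leaving S W" by (rule pick_SomeD(1)[OF assms])
  then have gS: "g \<in> S" by (simp add: leaving_def)
  then have "g \<in> E" using assms(1) by blast
  then obtain x y where xy: "ends g = {x, y}" "x \<noteq> y" "x \<in> V" "y \<in> V" by (rule ends_pair)
  have "(x \<in> W \<and> y \<notin> W) \<or> (y \<in> W \<and> x \<notin> W)"
    using g xy by (auto simp: leaving_def)
  then show thesis
  proof
    assume a: "x \<in> W \<and> y \<notin> W"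
    then have "ends g - W = {y}" using xy by auto
    then have "next_vertex S W = y" using assms(2) by (simp add: next_vertex_def)
    then show thesis using that[of x] a xy gS by auto
  next
    assume a: "y \<in> W \<and> x \<notin> W"
    then have "ends g - W = {x}" using xy by auto
    then have "next_vertex S W = x" using assms(2) by (simp add: next_vertex_def)
    then show thesis using that[of y] a xy gS by auto
  qed
qed

lemma next_vertex_in:
  assumes "S \<subseteq> E" "V - W \<noteq> {}"
  shows "next_vertex S W \<in> V - W"
proof (cases "pick S W")
  case None
  then show ?thesis using Min_in[of "V - W"] finite_V assms by (simp add: next_vertex_def)
next
  case (Some g)
  then show ?thesis by (rule leaving_ends[OF assms(1)]) simp
qed

lemma visited_card:
  assumes "S \<subseteq> E"
  shows "k \<le> card V \<Longrightarrow> visited S k \<subseteq> V \<and> card (visited S k) = k"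
proof (induction k)
  case (Suc k)
  then have IH: "visited S k \<subseteq> V" "card (visited S k) = k" by auto
  have "visited S k \<noteq> V" using IH(2) Suc.prems by auto
  then have "V - visited S k \<noteq> {}" using IH(1) by blast
  then have "next_vertex S (visited S k) \<in> V - visited S k" by (rule next_vertex_in[OF assms])
  then show ?case using IH finite_V
    by (auto simp: card_insert_if finite_subset)
qed simp

lemma visited_full: "S \<subseteq> E \<Longrightarrow> visited S (card V) = V"
  using visited_card[of S "card V"] finite_V by (simp add: card_subset_eq)

lemma visited_eq: "visited S k = (\<lambda>j. next_vertex S (visited S j)) ` {..<k}"
  by (induction k) (auto simp: lessThan_Suc)

lemma visited_mono: "j \<le> k \<Longrightarrow> visited S j \<subseteq> visited S k"
  by (rule lift_Suc_mono_le[of "visited S"]) auto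

section \<open>When and how a run enters a vertex set\<close>

text \<open>Thanks to the jumps the run visits all of \<open>V\<close> within \<open>card V\<close>
  steps, so the \<open>LEAST\<close> in \<open>hit_step\<close> is attained.\<close>

lemma hit_step_props:
  assumes "S \<subseteq> E" "U \<subseteq> V" "U \<noteq> {}"
  shows "first_hit U S \<in> U" "visited S (hit_step U S) \<inter> U = {}" "hit_step U S < card V"
proof -
  obtain u where "u \<in> U" "u \<in> visited S (card V)" using assms visited_full by auto
  then obtain j where j: "j < card V" "next_vertex S (visited S j) \<in> U" using visited_eq[of S "card V"] by auto
  show "first_hit U S \<in> U" unfolding first_hit_def hit_step_def using j(2) by (rule LeastI)
  show "hit_step U S < card V" unfolding hit_step_def using j by (meson Least_le order_le_less_trans)
  have "next_vertex S (visited S i) \<notin> U" if "i < hit_step U S" for i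
    using not_less_Least[of i "\<lambda>k. next_vertex S (visited S k) \<in> U"] that by (simp add: hit_step_def)
  then show "visited S (hit_step U S) \<inter> U = {}"
    by (subst visited_eq) auto
qed

lemma hit_step_eqI:
  assumes "next_vertex S (visited S k) \<in> U" "visited S k \<inter> U = {}"
  shows "hit_step U S = k"
  unfolding hit_step_def
proof (rule Least_equality)
  fix j assume "next_vertex S (visited S j) \<in> U"
  then have "\<not> j < k" using assms(2) unfolding visited_eq[of S k] by blast
  then show "k \<le> j" by simp
qed (use assms in simp)

lemma hit_step_le: "next_vertex S (visited S j) \<in> U \<Longrightarrow> hit_step U S \<le> j"
  unfolding hit_step_def by (rule Least_le)

lemma in_visited_iff:
  assumes "S \<subseteq> E" "z \<in> V" shows "z \<in> visited S k \<longleftrightarrow> hit_step {z} S < k"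
proof
  assume "z \<in> visited S k"
  then obtain j where "j < k" "next_vertex S (visited S j) = z" using visited_eq[of S k] by auto
  then show "hit_step {z} S < k" using hit_step_le[of S j "{z}"] by auto
next
  assume "hit_step {z} S < k"
  moreover have "next_vertex S (visited S (hit_step {z} S)) = z"
    using hit_step_props[of S "{z}"] assms by (simp add: first_hit_def)
  ultimately show "z \<in> visited S k" unfolding visited_eq[of S k] by force
qed

text \<open>Until the run touches \<open>U\<close> it never uses an edge meeting \<open>U\<close>, so deleting such
  edges does not change it.\<close>

lemma remove_incident:
  assumes S: "S \<subseteq> E" and S': "S' \<subseteq> S" and U: "U \<subseteq> V" "U \<noteq> {}"
    and inc: "\<And>g. g \<in> S - S' \<Longrightarrow> ends g \<inter> U \<noteq> {}"
    and hit_edge: "\<And>g. hit_edge U S = Some g \<Longrightarrow> g \<in> S'"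
  shows "hit_step U S' = hit_step U S" "hit_edge U S' = hit_edge U S" "first_hit U S' = first_hit U S"
    "visited S' (hit_step U S') = visited S (hit_step U S)"
proof -
  define k where "k = hit_step U S"
  have disj: "visited S k \<inter> U = {}" and hit: "next_vertex S (visited S k) \<in> U" and kc: "k < card V"
    using hit_step_props[OF S U] by (auto simp: k_def first_hit_def)
  have *: "visited S' j = visited S j" if "j \<le> k" for j
    using that
  proof (induction j)
    case (Suc j)
    have vj: "visited S' j = visited S j" using Suc by simp
    have "pick S' (visited S j) = pick S (visited S j)"
    proof (rule pick_remove[OF S S'])
      fix g assume g: "pick S (visited S j) = Some g"
      obtain a where a: "ends g = {a, next_vertex S (visited S j)}" "a \<in> visited S j" "g \<in> S"
        by (rule leaving_ends[OF S g])
      have "insert (next_vertex S (visited S j)) (visited S j) \<subseteq> visited S k"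
        using visited_mono[OF Suc.prems, of S] by simp
      then have "ends g \<inter> U = {}" using a disj by auto
      then show "g \<in> S'" using inc[of g] a by auto
    qed
    then show ?case using vj by (simp add: next_vertex_def)
  qed simp
  have pk: "pick S' (visited S' k) = pick S (visited S k)"
    using *[of k] hit_edge pick_remove[OF S S', of "visited S k"] by (simp add: hit_edge_def k_def)
  have nk: "next_vertex S' (visited S' k) = next_vertex S (visited S k)" using pk *[of k] by (simp add: next_vertex_def)
  have st: "hit_step U S' = k" by (rule hit_step_eqI) (use nk hit disj *[of k] in auto)
  show "hit_step U S' = hit_step U S" "hit_edge U S' = hit_edge U S" "first_hit U S' = first_hit U S"
    "visited S' (hit_step U S') = visited S (hit_step U S)"
    using st pk nk *[of k] by (auto simp: k_def hit_edge_def first_hit_def)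
qed

lemma hit_edge_SomeD:
  assumes "S \<subseteq> E" "U \<subseteq> V" "U \<noteq> {}" "hit_edge U S = Some g"
  obtains a where "g \<in> S" "ends g = {a, first_hit U S}" "a \<notin> U" "a \<noteq> first_hit U S" "first_hit U S \<in> U"
    "a \<in> visited S (hit_step U S)"
proof -
  have "pick S (visited S (hit_step U S)) = Some g" using assms by (simp add: hit_edge_def)
  then obtain a where "ends g = {a, first_hit U S}" "a \<in> visited S (hit_step U S)" "g \<in> S"
      "first_hit U S \<notin> visited S (hit_step U S)"
    unfolding first_hit_def by (rule leaving_ends[OF assms(1)])
  then show thesis using that hit_step_props[OF assms(1-3)] by auto
qed

text \<open>Before it enters \<open>y\<close>, the run on \<open>insert h S\<close> cannot have used
  \<open>h\<close>, which ends in \<open>y\<close>. So the run on \<open>S\<close> has gone the same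
  way, with \<open>x\<close> visited and \<open>y\<close> not yet. This orients all hitting edges
  along the visiting order of one fixed sample.\<close>

lemma hits_rank:
  assumes "S \<subseteq> E" "h \<in> E" "h \<notin> S" "hits S h y"
  obtains x where "ends h = {x, y}" "x \<in> V" "hit_step {x} S < hit_step {y} S"
proof -
  define S1 where "S1 = insert h S"
  have S1: "S1 \<subseteq> E" using assms by (simp add: S1_def)
  have y: "y \<in> V" "hit_edge {y} S1 = Some h" using assms(4) by (auto simp: hits_def S1_def)
  define k where "k = hit_step {y} S1"
  obtain x where x: "ends h = {x, first_hit {y} S1}" "x \<noteq> first_hit {y} S1" "x \<in> visited S1 k" "first_hit {y} S1 \<in> {y}"
    unfolding k_def by (rule hit_edge_SomeD[OF S1 _ _ y(2)]) (use y(1) in auto)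
  have xy: "ends h = {x, y}" "x \<noteq> y" using x by auto
  have yk: "y \<notin> visited S1 k" using hit_step_props[OF S1, of "{y}"] y by (auto simp: k_def)
  have *: "visited S j = visited S1 j" if "j \<le> k" for j
    using that
  proof (induction j)
    case (Suc j)
    have vj: "visited S j = visited S1 j" using Suc by simp
    have "pick S (visited S1 j) = pick S1 (visited S1 j)"
    proof (rule pick_remove[OF S1])
      show "S \<subseteq> S1" by (auto simp: S1_def)
      fix g assume g: "pick S1 (visited S1 j) = Some g"
      obtain a where a: "ends g = {a, next_vertex S1 (visited S1 j)}" "a \<in> visited S1 j" "g \<in> S1"
        by (rule leaving_ends[OF S1 g])
      have "insert (next_vertex S1 (visited S1 j)) (visited S1 j) \<subseteq> visited S1 k"
        using visited_mono[OF Suc.prems, of S1] by simp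
      then have "y \<notin> ends g" using a yk by auto
      then show "g \<in> S" using a xy by (auto simp: S1_def)
    qed
    then show ?case using vj by (simp add: next_vertex_def)
  qed simp
  have xV: "x \<in> V" using ends_subset[OF assms(2)] xy by auto
  have "hit_step {x} S < k" using *[of k] x(3) in_visited_iff[OF assms(1) xV] by auto
  moreover have "\<not> hit_step {y} S < k" using *[of k] yk in_visited_iff[OF assms(1) y(1)] by auto
  ultimately show thesis using that[of x] xy xV by auto
qed

end

section \<open>Connectivity and the maximum spanning forest\<close>

definition adj :: "('e \<Rightarrow> nat set) \<Rightarrow> 'e set \<Rightarrow> nat \<Rightarrow> nat \<Rightarrow> bool" where
  "adj ends S x y \<longleftrightarrow> (\<exists>g\<in>S. ends g = {x, y})"

definition conn :: "('e \<Rightarrow> nat set) \<Rightarrow> 'e set \<Rightarrow> nat \<Rightarrow> nat \<Rightarrow> bool" where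
  "conn ends S = (adj ends S)\<^sup>*\<^sup>*"

lemma conn_refl [simp]: "conn ends S x x"
  by (simp add: conn_def)

lemma conn_trans: "conn ends S x y \<Longrightarrow> conn ends S y z \<Longrightarrow> conn ends S x z"
  unfolding conn_def by (rule rtranclp_trans)

lemma conn_sym: "conn ends S x y \<Longrightarrow> conn ends S y x"
  unfolding conn_def
proof (induction rule: rtranclp_induct)
  case (step y z)
  then have "adj ends S z y" by (simp add: adj_def insert_commute)
  then show ?case using step.IH by (rule converse_rtranclp_into_rtranclp)
qed simp

lemma conn_mono: "S \<subseteq> T \<Longrightarrow> conn ends S x y \<Longrightarrow> conn ends T x y"
  unfolding conn_def by (erule rtranclp_mono[THEN predicate2D, rotated]) (fastforce simp: adj_def)

lemma conn_edge: "g \<in> S \<Longrightarrow> ends g = {x, y} \<Longrightarrow> conn ends S x y"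
  unfolding conn_def adj_def by (rule r_into_rtranclp) blast

context prim
begin

text \<open>The greedy forest in the form of the cycle rule: an edge is left out as soon as strictly
  better edges connect its ends.\<close>

definition max_forest :: "'e set" where
  "max_forest = {g \<in> E. \<forall>x y. ends g = {x, y} \<longrightarrow> \<not> conn ends {h \<in> E. h \<succ> g} x y}"

text \<open>If the run never picks \<open>e\<close> while it leaves the visited set, all later picks beat \<open>e\<close>.
  Going back to the last pick that does not beat \<open>e\<close>, every vertex reached since then hangs on
  another such vertex, as an edge to an older vertex would have been available at that last pick.\<close>

lemma forest_edge_is_hit_edge:
  assumes e: "e \<in> max_forest" "ends e = {u, v}" and S: "S \<subseteq> E" "e \<in> S"
    and hit: "first_hit {u, v} S = u"
  shows "hit_edge {v} S = Some e"
proof (rule ccontr)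
  assume neg: "hit_edge {v} S \<noteq> Some e"
  have eE: "e \<in> E" using e(1) by (simp add: max_forest_def)
  have uv: "u \<noteq> v" using card_ends[OF eE] e(2) by auto
  have V: "u \<in> V" "v \<in> V" using ends_subset[OF eE] e(2) by auto
  define x where "x j = next_vertex S (visited S j)" for j
  define k where "k = hit_step {u, v} S"
  define l where "l = hit_step {v} S"
  have xk: "x k = u" using hit by (simp add: x_def k_def first_hit_def)
  have xl: "x l = v" and vl: "v \<notin> visited S l" and l: "l < card V"
    using hit_step_props[OF S(1), of "{v}"] V by (auto simp: x_def l_def first_hit_def)
  have vk: "v \<notin> visited S k" using hit_step_props[OF S(1), of "{u, v}"] V by (auto simp: k_def)
  have "k \<le> l" using vk in_visited_iff[OF S(1) V(2), of k] by (simp add: l_def)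
  moreover have "k \<noteq> l" using xk xl uv by auto
  ultimately have kl: "k < l" by simp
  have beat: "\<exists>g. pick S (visited S j) = Some g \<and> g \<succ> e" if j: "k < j" "j \<le> l" for j
  proof -
    have uj: "u \<in> visited S j" unfolding visited_eq[of S j] using j(1) xk x_def by force
    have vj: "v \<notin> visited S j" using visited_mono[OF j(2), of S] vl by blast
    have lv: "e \<in> leaving S (visited S j)" using S(2) e(2) uj vj by (simp add: leaving_def)
    then obtain g where g: "pick S (visited S j) = Some g"
      using pick_None_iff[of S "visited S j"] by (cases "pick S (visited S j)") auto
    have "g \<noteq> e"
    proof
      assume "g = e"
      then obtain a where "ends e = {a, x j}" "a \<in> visited S j" "x j \<notin> visited S j"
        using leaving_ends[OF S(1) g] x_def by metis
      then have "x j = v" using e(2) uj vj by (metis doubleton_eq_iff)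
      then have "l \<le> j" using hit_step_le[of S j "{v}"] by (simp add: x_def l_def)
      then have "j = l" using j by simp
      then show False using neg g \<open>g = e\<close> by (simp add: hit_edge_def l_def)
    qed
    then have "g \<succ> e" using pick_SomeD(2)[OF S(1) g lv] by metis
    then show ?thesis using g by blast
  qed
  \<comment> \<open>The least \<open>i\<close> with \<open>P i\<close> is the last step whose pick
    does not beat \<open>e\<close>. A jump counts as such a step, and step 0 is always a
    jump.\<close>
  define P where "P i \<longleftrightarrow> (\<forall>j. i < j \<and> j \<le> l \<longrightarrow> (\<exists>g. pick S (visited S j) = Some g \<and> g \<succ> e))" for i
  have Pk: "P k" using beat by (auto simp: P_def)
  define i0 where "i0 = (LEAST i. P i)"
  have i0: "P i0" "i0 \<le> k" using Pk LeastI[of P k] Least_le[of P k] by (auto simp: i0_def)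
  let ?B = "{h \<in> E. h \<succ> e}"
  have con: "i0 \<le> j \<Longrightarrow> j \<le> l \<Longrightarrow> conn ends ?B (x i0) (x j)" for j
  proof (induction j rule: less_induct)
    case (less j)
    show ?case
    proof (cases "j = i0")
      case False
      then have j: "i0 < j" using less by simp
      then obtain g where g: "pick S (visited S j) = Some g" "g \<succ> e"
        using i0(1) less.prems by (auto simp: P_def)
      obtain a where a: "ends g = {a, x j}" "a \<in> visited S j" "x j \<notin> visited S j" "g \<in> S"
        using leaving_ends[OF S(1) g(1)] x_def by metis
      obtain i where i: "i < j" "x i = a" using a(2) unfolding visited_eq[of S j] x_def by auto
      have "i0 \<le> i"
      proof (rule ccontr)
        assume "\<not> i0 \<le> i"
        then have ii: "i < i0" by simp
        have "a \<in> visited S i0" unfolding visited_eq[of S i0] using ii i(2) x_def by force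
        moreover have "x j \<notin> visited S i0" using visited_mono[of i0 j S] j a(3) by auto
        ultimately have lv: "g \<in> leaving S (visited S i0)" using a by (simp add: leaving_def)
        then obtain g' where g': "pick S (visited S i0) = Some g'"
          using pick_None_iff[of S "visited S i0"] by (cases "pick S (visited S i0)") auto
        have g'e: "g' \<succ> e"
          using pick_SomeD(2)[OF S(1) g' lv] g(2) better_trans by (cases "g' = g") auto
        have "P (i0 - 1)"
          unfolding P_def
        proof (intro allI impI)
          fix j' assume j': "i0 - 1 < j' \<and> j' \<le> l"
          show "\<exists>g. pick S (visited S j') = Some g \<and> g \<succ> e"
          proof (cases "j' = i0")
            case True then show ?thesis using g' g'e by blast
          next
            case False then have "i0 < j'" using j' ii by arith
            then show ?thesis using i0(1) j' by (simp add: P_def)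
          qed
        qed
        then have "i0 \<le> i0 - 1" unfolding i0_def by (rule Least_le)
        then show False using ii by simp
      qed
      then have "conn ends ?B (x i0) a" using less.IH[of i] i less.prems by auto
      moreover have "conn ends ?B a (x j)"
        by (rule conn_edge[of g]) (use a S g in auto)
      ultimately show ?thesis by (rule conn_trans)
    qed simp
  qed
  have "conn ends ?B u v"
    using conn_trans[OF conn_sym[OF con[of k]] con[of l]] i0 kl xk xl by simp
  then show False using e by (simp add: max_forest_def)
qed

end

section \<open>Independent random subsets\<close>

text \<open>The expectation of \<open>F\<close> over a random subset of \<open>X\<close> that
  contains each element independently with probability \<open>q\<close>. As an explicit finite sum
  it can be integrated over the arrival time term by term.\<close>

definition subset_expect :: "real \<Rightarrow> 'a set \<Rightarrow> ('a set \<Rightarrow> real) \<Rightarrow> real" where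
  "subset_expect q X F = (\<Sum>J\<in>Pow X. q ^ card J * (1 - q) ^ card (X - J) * F J)"

lemma subset_expect_empty [simp]: "subset_expect q {} F = F {}"
  by (simp add: subset_expect_def)

lemma subset_expect_insert:
  assumes "finite X" "x \<notin> X"
  shows "subset_expect q (insert x X) F = q * subset_expect q X (\<lambda>J. F (insert x J)) + (1 - q) * subset_expect q X F"
proof -
  have inj: "inj_on (insert x) (Pow X)"
    using assms by (auto simp: inj_on_def)
  have dis: "Pow X \<inter> insert x ` Pow X = {}" using assms by auto
  have "subset_expect q (insert x X) F =
      (\<Sum>J\<in>Pow X. q ^ card J * (1 - q) ^ card (insert x X - J) * F J)
      + (\<Sum>J\<in>Pow X. q ^ card (insert x J) * (1 - q) ^ card (insert x X - insert x J) * F (insert x J))"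
    unfolding subset_expect_def Pow_insert using assms dis inj
    by (subst sum.union_disjoint) (auto simp: sum.reindex)
  also have "(\<Sum>J\<in>Pow X. q ^ card J * (1 - q) ^ card (insert x X - J) * F J) = (1 - q) * subset_expect q X F"
    unfolding subset_expect_def sum_distrib_left
  proof (rule sum.cong)
    fix J assume "J \<in> Pow X"
    then have "insert x X - J = insert x (X - J)" using assms by auto
    then have "card (insert x X - J) = Suc (card (X - J))" using assms by simp
    then show "q ^ card J * (1 - q) ^ card (insert x X - J) * F J =
        (1 - q) * (q ^ card J * (1 - q) ^ card (X - J) * F J)" by simp
  qed simp
  also have "(\<Sum>J\<in>Pow X. q ^ card (insert x J) * (1 - q) ^ card (insert x X - insert x J) * F (insert x J))
      = q * subset_expect q X (\<lambda>J. F (insert x J))"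
    unfolding subset_expect_def sum_distrib_left
  proof (rule sum.cong)
    fix J assume J: "J \<in> Pow X"
    then have "insert x X - insert x J = X - J" "x \<notin> J" "finite J"
      using assms finite_subset by auto
    then show "q ^ card (insert x J) * (1 - q) ^ card (insert x X - insert x J) * F (insert x J) =
        q * (q ^ card J * (1 - q) ^ card (X - J) * F (insert x J))" by simp
  qed simp
  finally show ?thesis by simp
qed

lemma subset_expect_const [simp]: "finite X \<Longrightarrow> subset_expect q X (\<lambda>_. c) = c"
  by (induction X rule: finite_induct) (auto simp: subset_expect_insert algebra_simps)

lemma subset_expect_mono:
  assumes "0 \<le> q" "q \<le> 1" "\<And>J. J \<subseteq> X \<Longrightarrow> F J \<le> G J"
  shows "subset_expect q X F \<le> subset_expect q X G"
  unfolding subset_expect_def using assms by (intro sum_mono mult_left_mono) auto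

lemma subset_expect_cong:
  assumes "\<And>J. J \<subseteq> X \<Longrightarrow> F J = G J"
  shows "subset_expect q X F = subset_expect q X G"
  unfolding subset_expect_def using assms by (intro sum.cong) auto

lemma subset_expect_cmult: "subset_expect q X (\<lambda>J. c * F J) = c * subset_expect q X F"
  unfolding subset_expect_def by (simp add: sum_distrib_left mult_ac)

lemma subset_expect_add: "subset_expect q X (\<lambda>J. F J + G J) = subset_expect q X F + subset_expect q X G"
  unfolding subset_expect_def by (simp add: sum.distrib distrib_left)

lemma subset_expect_lower:
  assumes "finite X" "0 \<le> q" "q \<le> 1" "\<And>J. J \<subseteq> X \<Longrightarrow> c \<le> F J"
  shows "c \<le> subset_expect q X F"
  using subset_expect_mono[OF assms(2,3), of X "\<lambda>_. c" F] assms by simp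

lemma subset_expect_union:
  assumes "finite X" "finite Y" "X \<inter> Y = {}"
  shows "subset_expect q (X \<union> Y) F = subset_expect q X (\<lambda>I. subset_expect q Y (\<lambda>J. F (I \<union> J)))"
  using assms
proof (induction X arbitrary: F rule: finite_induct)
  case (insert x X)
  have "subset_expect q (insert x X \<union> Y) F = subset_expect q (insert x (X \<union> Y)) F" by simp
  also have "\<dots> = q * subset_expect q (X \<union> Y) (\<lambda>J. F (insert x J)) + (1 - q) * subset_expect q (X \<union> Y) F"
    using insert by (intro subset_expect_insert) auto
  also have "\<dots> = subset_expect q (insert x X) (\<lambda>I. subset_expect q Y (\<lambda>J. F (I \<union> J)))"
    using insert by (simp add: subset_expect_insert)
  finally show ?case .
qed simp

lemma subset_expect_swap:
  "subset_expect q X (\<lambda>I. subset_expect r Y (\<lambda>J. F I J)) = subset_expect r Y (\<lambda>J. subset_expect q X (\<lambda>I. F I J))"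
  unfolding subset_expect_def sum_distrib_left
  by (subst sum.swap) (simp add: mult_ac)

lemma subset_expect_member:
  assumes "finite X" "c \<in> X"
  shows "subset_expect q X (\<lambda>J. if c \<in> J then a else b) = q * a + (1 - q) * b"
proof -
  have X: "insert c (X - {c}) = X" using assms by auto
  have "subset_expect q (X - {c}) (\<lambda>J. if c \<in> J then a else b) = subset_expect q (X - {c}) (\<lambda>_. b)"
    by (rule subset_expect_cong) auto
  then show ?thesis
    using assms subset_expect_insert[of "X - {c}" c q "\<lambda>J. if c \<in> J then a else b"] unfolding X by simp
qed

lemma subset_expect_either:
  assumes "finite X" "c \<in> X" "d \<in> X" "c \<noteq> d"
  shows "subset_expect q X (\<lambda>J. if c \<in> J \<or> d \<in> J then 1 else 0) = q + q * (1 - q)"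
proof -
  have X: "insert c (X - {c}) = X" using assms by auto
  have "subset_expect q (X - {c}) (\<lambda>J. if c \<in> J \<or> d \<in> J then 1 else 0)
      = subset_expect q (X - {c}) (\<lambda>J. if d \<in> J then 1 else 0)"
    by (rule subset_expect_cong) auto
  also have "\<dots> = q" using assms by (subst subset_expect_member) auto
  finally show ?thesis
    using assms subset_expect_insert[of "X - {c}" c q "\<lambda>J. if c \<in> J \<or> d \<in> J then 1 else 0"] unfolding X
    by (simp add: algebra_simps)
qed

text \<open>The left side is the probability that all of \<open>P\<close> and nothing of
  \<open>N\<close> is chosen; the choices on the rest of \<open>X\<close> average out.\<close>

lemma subset_expect_lower_on:
  assumes q: "0 \<le> q" "q \<le> 1" and X: "finite X" and PN: "P \<subseteq> X" "N \<subseteq> X" "P \<inter> N = {}"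
    and F: "\<And>J. J \<subseteq> X \<Longrightarrow> 0 \<le> F J" "\<And>J. J \<subseteq> X \<Longrightarrow> P \<subseteq> J \<Longrightarrow> J \<inter> N = {} \<Longrightarrow> 1 \<le> F J"
  shows "q ^ card P * (1 - q) ^ card N \<le> subset_expect q X F"
proof -
  define H :: "'a set \<Rightarrow> real" where "H J = (if P \<subseteq> J \<and> J \<inter> N = {} then 1 else 0)" for J
  define W where "W = X - P - N"
  have W: "finite W" "W \<inter> P = {}" "W \<inter> N = {}" using X by (auto simp: W_def)
  have fin: "finite P" "finite N" using PN(1,2) X by (auto dest: finite_subset)
  have "subset_expect q X H = subset_expect q (P \<union> (N \<union> W)) H"
    using PN by (intro arg_cong2[of _ _ _ _ "subset_expect q"]) (auto simp: W_def)
  also have "\<dots> = subset_expect q P (\<lambda>I. subset_expect q N (\<lambda>J. subset_expect q W (\<lambda>K. H (I \<union> (J \<union> K)))))"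
  proof -
    have "P \<inter> (N \<union> W) = {}" "N \<inter> W = {}" using PN W by auto
    then show ?thesis using fin W by (simp add: subset_expect_union)
  qed
  also have "\<dots> = subset_expect q P (\<lambda>I. subset_expect q N (\<lambda>J. if I = P \<and> J = {} then 1 else 0))"
  proof (rule subset_expect_cong, rule subset_expect_cong)
    fix I J assume IJ: "I \<subseteq> P" "J \<subseteq> N"
    have "subset_expect q W (\<lambda>K. H (I \<union> (J \<union> K))) = subset_expect q W (\<lambda>_. if I = P \<and> J = {} then 1 else 0)"
    proof (rule subset_expect_cong)
      fix K assume "K \<subseteq> W"
      then have "P \<subseteq> I \<union> (J \<union> K) \<longleftrightarrow> I = P" "(I \<union> (J \<union> K)) \<inter> N = {} \<longleftrightarrow> J = {}"
        using IJ PN W by blast+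
      then show "H (I \<union> (J \<union> K)) = (if I = P \<and> J = {} then 1 else 0)" by (simp add: H_def)
    qed
    then show "subset_expect q W (\<lambda>K. H (I \<union> (J \<union> K))) = (if I = P \<and> J = {} then 1 else 0)"
      using W by simp
  qed
  also have "\<dots> = subset_expect q P (\<lambda>I. if I = P then (1 - q) ^ card N else 0)"
  proof (rule subset_expect_cong)
    fix I assume "I \<subseteq> P"
    have "subset_expect q N (\<lambda>J. if I = P \<and> J = {} then 1 else 0) =
        (\<Sum>J\<in>Pow N. if J = {} then (if I = P then (1 - q) ^ card N else 0) else 0)"
      unfolding subset_expect_def by (intro sum.cong) auto
    also have "\<dots> = (if I = P then (1 - q) ^ card N else 0)" using fin by (subst sum.delta) auto
    finally show "subset_expect q N (\<lambda>J. if I = P \<and> J = {} then 1 else 0) = (if I = P then (1 - q) ^ card N else 0)" .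
  qed
  also have "\<dots> = (\<Sum>I\<in>Pow P. if I = P then q ^ card P * (1 - q) ^ card N else 0)"
    unfolding subset_expect_def by (intro sum.cong) auto
  also have "\<dots> = q ^ card P * (1 - q) ^ card N" using fin by (subst sum.delta) auto
  finally have "q ^ card P * (1 - q) ^ card N = subset_expect q X H" by simp
  also have "\<dots> \<le> subset_expect q X F"
    by (rule subset_expect_mono[OF q]) (use F in \<open>auto simp: H_def\<close>)
  finally show ?thesis .
qed

section \<open>The probability that a forest edge is accepted\<close>

context prim
begin

text \<open>\<open>A\<close> plays the sample and \<open>B\<close> the edges that came between the
  sample and \<open>e\<close>. An edge of \<open>B\<close> blocks the vertex it hits even if it was
  itself rejected.\<close>

definition accepts :: "'e set \<Rightarrow> 'e set \<Rightarrow> 'e \<Rightarrow> bool" where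
  "accepts A B e \<longleftrightarrow> (\<exists>v\<in>ends e. hits A e v \<and> (\<forall>h\<in>B. \<not> hits A h v))"

text \<open>In both hypotheses the edges of \<open>X\<close> at \<open>v\<close> are present whether
  sampled or not, up to those joining \<open>u\<close> and \<open>v\<close> in the first. So the
  first hypothesis depends only on the sampled edges away from \<open>v\<close>, and the second asks
  for one particular edge to be sampled, which separates the two random choices. The criterion holds
  because the runs that decide about \<open>e\<close> arise by deleting edges other than the entry
  edges.\<close>

lemma accepts_criterion:
  assumes e: "e \<in> max_forest" "ends e = {u, v}" and AX: "A \<subseteq> X" "X \<subseteq> E - {e}"
    and first: "first_hit {u, v} ({g \<in> A. v \<notin> ends g} \<union> {g \<in> X. v \<in> ends g \<and> u \<notin> ends g}) = u"
    and hit_edge: "\<And>c. hit_edge {v} ({g \<in> A. v \<notin> ends g} \<union> {g \<in> X. v \<in> ends g}) = Some c \<Longrightarrow> c \<in> A"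
  shows "accepts A (X - A) e"
proof -
  have eE: "e \<in> E" using e(1) by (simp add: max_forest_def)
  have V: "{u, v} \<subseteq> V" using ends_subset[OF eE] e(2) by auto
  have ne: "{u, v} \<noteq> {}" by simp
  define Z where "Z = {g \<in> A. v \<notin> ends g} \<union> {g \<in> X. v \<in> ends g}"
  \<comment> \<open>\<open>Y\<close> lies above both sets to be compared: deleting the edges that
    join \<open>u\<close> and \<open>v\<close> gives the set in \<open>first\<close>, and deleting
    the unsampled edges at \<open>v\<close> other than \<open>e\<close> gives the set on which
    \<open>e\<close> is tested.\<close>
  define Y where "Y = insert e Z"
  have ZE: "Z \<subseteq> E" and YE: "Y \<subseteq> E" using AX eE by (auto simp: Y_def Z_def)
  have no_uv: "\<not> (u \<in> ends g \<and> v \<in> ends g)" if g: "hit_edge {u, v} Y = Some g" for g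
  proof -
    obtain a where "ends g = {a, first_hit {u, v} Y}" "a \<notin> {u, v}" "g \<in> Y" "first_hit {u, v} Y \<in> {u, v}"
      by (rule hit_edge_SomeD[OF YE V ne g])
    moreover have "u \<noteq> v" using card_ends[OF eE] e(2) by auto
    ultimately show ?thesis by auto
  qed
  have "first_hit {u, v} ({g \<in> A. v \<notin> ends g} \<union> {g \<in> X. v \<in> ends g \<and> u \<notin> ends g}) = first_hit {u, v} Y"
  proof (rule remove_incident(3)[OF YE _ V ne])
    fix g assume g: "hit_edge {u, v} Y = Some g"
    have "g \<in> Y" by (rule hit_edge_SomeD[OF YE V ne g])
    then show "g \<in> {g \<in> A. v \<notin> ends g} \<union> {g \<in> X. v \<in> ends g \<and> u \<notin> ends g}"
      using no_uv[OF g] e(2) by (auto simp: Y_def Z_def)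
  qed (use e(2) in \<open>auto simp: Y_def Z_def\<close>)
  then have Yu: "first_hit {u, v} Y = u" using first by simp
  have "first_hit {u, v} (insert e A) = first_hit {u, v} Y"
  proof (rule remove_incident(3)[OF YE _ V ne])
    show "insert e A \<subseteq> Y" using AX by (auto simp: Y_def Z_def)
    fix g assume g: "hit_edge {u, v} Y = Some g"
    have "g \<in> Y" by (rule hit_edge_SomeD[OF YE V ne g])
    moreover have "u \<in> ends g" by (rule hit_edge_SomeD[OF YE V ne g]) (use Yu in auto)
    ultimately show "g \<in> insert e A" using no_uv[OF g] by (auto simp: Y_def Z_def)
  qed (auto simp: Y_def Z_def)
  then have "first_hit {u, v} (insert e A) = u" using Yu by simp
  then have "hit_edge {v} (insert e A) = Some e"
    by (rule forest_edge_is_hit_edge[OF e, rotated 2]) (use AX eE in auto)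
  then have "hits A e v" using V by (simp add: hits_def)
  \<comment> \<open>If \<open>h\<close> hit \<open>v\<close>, the run on \<open>Z\<close> would also
    enter \<open>v\<close> through \<open>h\<close>, and then \<open>h\<close> would have to be
    sampled.\<close>
  moreover have "\<not> hits A h v" if h: "h \<in> X - A" for h
  proof
    assume hit: "hits A h v"
    have hA: "insert h A \<subseteq> E" using h AX by auto
    have arch: "hit_edge {v} (insert h A) = Some h" using hit by (simp add: hits_def)
    have vV: "{v} \<subseteq> V" using V by auto
    have vh: "v \<in> ends h" by (rule hit_edge_SomeD[OF hA vV _ arch]) auto
    have "hit_edge {v} (insert h A) = hit_edge {v} Z"
      by (rule remove_incident(2)[OF ZE _ vV]) (use h vh AX hit_edge in \<open>auto simp: Z_def\<close>)
    then have "h \<in> A" using hit_edge[of h] arch by (simp add: Z_def)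
    then show False using h by simp
  qed
  ultimately show ?thesis using e(2) by (auto simp: accepts_def)
qed

text \<open>Losing the best entry edge does no harm: the next best one, or a jump, enters
  \<open>U\<close> at the same vertex.\<close>

definition robust :: "nat set \<Rightarrow> 'e set \<Rightarrow> bool" where
  "robust U S \<longleftrightarrow> (\<forall>c. hit_edge U S = Some c \<longrightarrow> first_hit U (S - {c}) = first_hit U S)"

text \<open>\<open>XR\<close>, \<open>XI\<close> and \<open>XP\<close> are the edges that came
  before \<open>e\<close>, split by whether they meet neither end of \<open>e\<close>, exactly one
  or both. The sample on \<open>XR\<close> is fixed as \<open>SR\<close>. The outer factor
  \<open>q\<close> is the price for sampling the edge through which \<open>v\<close> would be
  entered, the inner bracket that for keeping the entry at \<open>u\<close>.\<close>

lemma accept_prob_first: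
  assumes e: "e \<in> max_forest" "ends e = {u, v}" and q: "0 \<le> q" "q \<le> 1"
    and R: "SR \<subseteq> XR" "XR \<subseteq> E - {e}" "\<And>g. g \<in> XR \<Longrightarrow> u \<notin> ends g \<and> v \<notin> ends g"
    and I: "XI \<subseteq> E - {e}" "\<And>g. g \<in> XI \<Longrightarrow> (u \<in> ends g) \<noteq> (v \<in> ends g)"
    and P: "XP \<subseteq> E - {e}" "\<And>g. g \<in> XP \<Longrightarrow> u \<in> ends g \<and> v \<in> ends g"
    and first: "first_hit {u, v} (SR \<union> XI) = u"
  shows "q * (q + (if robust {u, v} (SR \<union> XI) then q * (1 - q) else 0))
    \<le> subset_expect q (XI \<union> XP) (\<lambda>A. of_bool (accepts (SR \<union> A) ((XR \<union> (XI \<union> XP)) - (SR \<union> A)) e))"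
proof -
  let ?U = "{u, v}"
  let ?F = "\<lambda>A. of_bool (accepts (SR \<union> A) ((XR \<union> (XI \<union> XP)) - (SR \<union> A)) e) :: real"
  define S where "S = SR \<union> XI"
  define Xu where "Xu = {g \<in> XI. u \<in> ends g}"
  define Xv where "Xv = {g \<in> XI. v \<in> ends g}"
  have eE: "e \<in> E" using e(1) by (simp add: max_forest_def)
  have V: "?U \<subseteq> V" using ends_subset[OF eE] e(2) by auto
  have ne: "?U \<noteq> {}" by simp
  have XI: "XI = Xu \<union> Xv" "Xu \<inter> Xv = {}" using I(2) by (auto simp: Xu_def Xv_def)
  have Xsub: "Xu \<subseteq> XI" "Xv \<subseteq> XI" using XI by auto
  have Xu: "u \<in> ends g" "v \<notin> ends g" if "g \<in> Xu" for g using that I(2) by (auto simp: Xu_def)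
  have Xv: "v \<in> ends g" "u \<notin> ends g" if "g \<in> Xv" for g using that I(2) by (auto simp: Xv_def)
  have in_XI: "g \<in> Xu \<or> g \<in> Xv" if "g \<in> XI" for g using that XI(1) by blast
  have fin: "finite XI" "finite XP" "finite Xu" "finite Xv"
    using finite_sub[of XI] finite_sub[of XP] I(1) P(1)
    by (auto simp: Xu_def Xv_def subset_Diff_insert)
  have SE: "S \<subseteq> E" using R I by (auto simp: S_def)
  \<comment> \<open>\<open>Eu A\<close> is the hypothesis \<open>first\<close> of
    \<open>accepts_criterion\<close> when \<open>A\<close> is the set of sampled edges at
    \<open>u\<close>.\<close>
  define Eu where "Eu A \<longleftrightarrow> first_hit ?U (SR \<union> A \<union> Xv) = u" for A
  \<comment> \<open>Once the sampled edges at \<open>u\<close> are known, \<open>Z\<close> is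
    determined. Its entry edge at \<open>v\<close>, if any, is one fixed edge of
    \<open>Xv \<union> XP\<close> and is sampled with probability \<open>q\<close>.\<close>
  have given_Eu: "q \<le> subset_expect q (Xv \<union> XP) (\<lambda>A'. ?F (A \<union> A'))" if A: "A \<subseteq> Xu" "Eu A" for A
  proof -
    define Z where "Z = SR \<union> A \<union> (Xv \<union> XP)"
    have acc: "?F (A \<union> A') = 1" if A': "A' \<subseteq> Xv \<union> XP" "\<And>c. hit_edge {v} Z = Some c \<Longrightarrow> c \<in> A'" for A'
    proof -
      have 1: "{g \<in> SR \<union> (A \<union> A'). v \<notin> ends g} = SR \<union> A"
      proof -
        have "v \<notin> ends g" if "g \<in> SR \<union> A" for g using that A(1) R(1,3) Xu by blast
        moreover have "v \<in> ends g" if "g \<in> A'" for g using that A'(1) P(2) Xv by blast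
        ultimately show ?thesis by blast
      qed
      have 2: "{g \<in> XR \<union> (XI \<union> XP). v \<in> ends g} = Xv \<union> XP"
        using R(3) P(2) Xsub Xu Xv in_XI by blast
      have 3: "{g \<in> XR \<union> (XI \<union> XP). v \<in> ends g \<and> u \<notin> ends g} = Xv"
        using R(3) P(2) Xsub Xu Xv in_XI by blast
      have "accepts (SR \<union> (A \<union> A')) ((XR \<union> (XI \<union> XP)) - (SR \<union> (A \<union> A'))) e"
      proof (rule accepts_criterion[OF e])
        show "SR \<union> (A \<union> A') \<subseteq> XR \<union> (XI \<union> XP)" using A A' R XI by auto
        show "XR \<union> (XI \<union> XP) \<subseteq> E - {e}" using R I P by auto
        show "first_hit {u, v} ({g \<in> SR \<union> (A \<union> A'). v \<notin> ends g}
            \<union> {g \<in> XR \<union> (XI \<union> XP). v \<in> ends g \<and> u \<notin> ends g}) = u"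
          unfolding 1 3 using A(2) by (simp add: Eu_def)
        show "c \<in> SR \<union> (A \<union> A')" if "hit_edge {v} ({g \<in> SR \<union> (A \<union> A'). v \<notin> ends g}
            \<union> {g \<in> XR \<union> (XI \<union> XP). v \<in> ends g}) = Some c" for c
          using that A'(2)[of c] unfolding 1 2 by (simp add: Z_def Un_assoc)
      qed
      then show ?thesis by simp
    qed
    show ?thesis
    proof (cases "hit_edge {v} Z")
      case None
      show ?thesis
        by (rule subset_expect_lower) (use acc None fin q in auto)
    next
      case (Some c)
      have ZE: "Z \<subseteq> E" using R A XI I P by (auto simp: Z_def)
      obtain a where "ends c = {a, first_hit {v} Z}" "c \<in> Z" "first_hit {v} Z \<in> {v}"
        by (rule hit_edge_SomeD[OF ZE _ _ Some]) (use V in auto)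
      then have "v \<in> ends c" "c \<in> SR \<union> A \<union> (Xv \<union> XP)" by (auto simp: Z_def)
      then have "c \<in> Xv \<union> XP"
        using R(1,3) A(1) Xu by blast
      then have "q = subset_expect q (Xv \<union> XP) (\<lambda>A'. if c \<in> A' then 1 else 0)"
        using fin by (subst subset_expect_member) auto
      also have "\<dots> \<le> subset_expect q (Xv \<union> XP) (\<lambda>A'. ?F (A \<union> A'))"
      proof (rule subset_expect_mono[OF q])
        fix J assume J: "J \<subseteq> Xv \<union> XP"
        show "(if c \<in> J then 1 else 0) \<le> ?F (A \<union> J)"
        proof (cases "c \<in> J")
          case True
          then have "?F (A \<union> J) = 1" using Some by (intro acc[OF J]) auto
          then show ?thesis by simp
        qed simp
      qed
      finally show ?thesis .
    qed
  qed
  \<comment> \<open>Dropping unsampled edges at \<open>u\<close> keeps the entry as long as the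
    entry edge of \<open>T\<close> is sampled. This serves for \<open>T = S\<close> and, if the best
    edge \<open>c\<close> is unsampled, for \<open>T = S - {c}\<close>.\<close>
  have Eu_if: "Eu A" if A: "A \<subseteq> Xu" and T: "T \<subseteq> S" "SR \<union> A \<union> Xv \<subseteq> T" "first_hit ?U T = u"
    and c: "\<And>c. hit_edge ?U T = Some c \<Longrightarrow> c \<in> A" for A T
  proof -
    have "first_hit ?U (SR \<union> A \<union> Xv) = first_hit ?U T"
    proof (rule remove_incident(3)[OF _ T(2) V ne])
      show "T \<subseteq> E" using T(1) SE by blast
      show "ends g \<inter> ?U \<noteq> {}" if "g \<in> T - (SR \<union> A \<union> Xv)" for g
        using that T(1) in_XI[of g] Xu[of g] unfolding S_def by blast
      show "g \<in> SR \<union> A \<union> Xv" if "hit_edge ?U T = Some g" for g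
        using c[OF that] by simp
    qed
    then show ?thesis using T(3) by (simp add: Eu_def)
  qed
  have in_Xu: "c \<in> Xu" if T: "T \<subseteq> S" "first_hit ?U T = u" "hit_edge ?U T = Some c" for c T
  proof -
    have TE: "T \<subseteq> E" using T(1) SE by auto
    obtain a where "ends c = {a, first_hit ?U T}" "c \<in> T" 
      by (rule hit_edge_SomeD[OF TE V ne T(3)])
    then have "u \<in> ends c" "c \<in> SR \<union> XI" using T by (auto simp: S_def)
    then show ?thesis using R(1,3) in_XI Xv by blast
  qed
  have qq: "q + q * (1 - q) \<le> 1" "0 \<le> q * (1 - q)"
  proof -
    have "0 \<le> (1 - q) * (1 - q)" by (rule zero_le_square)
    then show "q + q * (1 - q) \<le> 1" by (simp add: algebra_simps)
    show "0 \<le> q * (1 - q)" using q by simp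
  qed
  \<comment> \<open>The bound is the chance that the best edge \<open>c\<close> is sampled or, in
    the robust case, that \<open>c\<close> or the runner-up \<open>d\<close> is.\<close>
  have "q + (if robust ?U S then q * (1 - q) else 0) \<le> subset_expect q Xu (\<lambda>A. of_bool (Eu A))"
  proof (cases "hit_edge ?U S")
    case None
    have "Eu A" if "A \<subseteq> Xu" for A
      by (rule Eu_if[OF that, of S]) (use that None first Xsub in \<open>auto simp: S_def\<close>)
    then have "1 \<le> subset_expect q Xu (\<lambda>A. of_bool (Eu A))"
      by (intro subset_expect_lower) (use fin q in auto)
    then show ?thesis using qq by auto
  next
    case (Some c)
    have cXu: "c \<in> Xu" by (rule in_Xu[OF _ _ Some]) (use first in \<open>auto simp: S_def\<close>)
    have Eu1: "Eu A" if "A \<subseteq> Xu" "c \<in> A" for A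
      by (rule Eu_if[OF that(1), of S]) (use that Some first Xsub in \<open>auto simp: S_def\<close>)
    show ?thesis
    proof (cases "robust ?U S")
      case False
      have "q = subset_expect q Xu (\<lambda>A. if c \<in> A then 1 else 0)"
        using fin cXu by (subst subset_expect_member) auto
      also have "\<dots> \<le> subset_expect q Xu (\<lambda>A. of_bool (Eu A))"
        by (rule subset_expect_mono[OF q]) (use Eu1 in auto)
      finally show ?thesis using False by simp
    next
      case True
      then have f2: "first_hit ?U (S - {c}) = u" using Some first by (simp add: robust_def S_def)
      have cv: "c \<notin> SR \<union> Xv" using cXu R(1,3) XI(2) Xu by blast
      have Eu2: "Eu A" if A: "A \<subseteq> Xu" "c \<notin> A" "\<And>d. hit_edge ?U (S - {c}) = Some d \<Longrightarrow> d \<in> A" for A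
        by (rule Eu_if[OF A(1), of "S - {c}"]) (use A f2 cv Xsub in \<open>auto simp: S_def\<close>)
      show ?thesis
      proof (cases "hit_edge ?U (S - {c})")
        case None
        have "1 \<le> subset_expect q Xu (\<lambda>A. of_bool (Eu A))"
        proof (rule subset_expect_lower[OF fin(3) q])
          fix A assume "A \<subseteq> Xu"
          then show "1 \<le> (of_bool (Eu A) :: real)"
            using Eu1[of A] Eu2[of A] None by (cases "c \<in> A") auto
        qed
        then show ?thesis using qq True by auto
      next
        case (Some d)
        have dXu: "d \<in> Xu" by (rule in_Xu[OF _ f2 Some]) auto
        have "d \<noteq> c"
        proof -
          have "S - {c} \<subseteq> E" using SE by auto
          then have "d \<in> S - {c}" by (rule hit_edge_SomeD[OF _ V ne Some])
          then show ?thesis by auto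
        qed
        then have "q + q * (1 - q) = subset_expect q Xu (\<lambda>A. if c \<in> A \<or> d \<in> A then 1 else 0)"
          using subset_expect_either[OF fin(3) cXu dXu] by simp
        also have "\<dots> \<le> subset_expect q Xu (\<lambda>A. of_bool (Eu A))"
        proof (rule subset_expect_mono[OF q])
          fix A assume "A \<subseteq> Xu"
          then show "(if c \<in> A \<or> d \<in> A then 1 else 0) \<le> (of_bool (Eu A) :: real)"
            using Eu1[of A] Eu2[of A] Some by (cases "c \<in> A") auto
        qed
        finally show ?thesis using True by simp
      qed
    qed
  qed
  then have "q * (q + (if robust ?U S then q * (1 - q) else 0)) \<le> q * subset_expect q Xu (\<lambda>A. of_bool (Eu A))"
    using q by (intro mult_left_mono)
  also have "\<dots> = subset_expect q Xu (\<lambda>A. q * of_bool (Eu A))" by (simp add: subset_expect_cmult)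
  also have "\<dots> \<le> subset_expect q Xu (\<lambda>A. subset_expect q (Xv \<union> XP) (\<lambda>A'. ?F (A \<union> A')))"
  proof (rule subset_expect_mono[OF q])
    fix A assume A: "A \<subseteq> Xu"
    have "0 \<le> subset_expect q (Xv \<union> XP) (\<lambda>A'. ?F (A \<union> A'))"
      by (rule subset_expect_lower) (use fin q in auto)
    then show "q * of_bool (Eu A) \<le> subset_expect q (Xv \<union> XP) (\<lambda>A'. ?F (A \<union> A'))"
      using given_Eu[OF A] by (cases "Eu A") auto
  qed
  also have "\<dots> = subset_expect q (Xu \<union> (Xv \<union> XP)) ?F"
  proof -
    have "Xu \<inter> (Xv \<union> XP) = {}" using XI(2) P(2) Xu by blast
    then show ?thesis using fin by (simp add: subset_expect_union)
  qed
  also have "Xu \<union> (Xv \<union> XP) = XI \<union> XP" using XI by auto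
  finally show ?thesis by (simp add: S_def)
qed

text \<open>Let \<open>c1\<close>, \<open>c2\<close> and a third edge be the successive best entry
  edges of \<open>I\<close>. Two of their three entry vertices agree. If the corresponding edges are
  in \<open>X\<close> and, where necessary, the other of \<open>c1\<close> and \<open>c2\<close> is
  not, they are the top two of \<open>X\<close>, at cost \<open>t\<^sup>2\<close> or
  \<open>t\<^sup>2 * (1 - t)\<close>. Where the ranking stops early a jump takes the place of the
  missing edge, which only helps.\<close>

lemma robust_prob:
  assumes U: "U \<subseteq> V" "card U = 2" and SR: "SR \<subseteq> E" "\<And>g. g \<in> SR \<Longrightarrow> ends g \<inter> U = {}"
    and I: "I \<subseteq> E" "\<And>g. g \<in> I \<Longrightarrow> ends g \<inter> U \<noteq> {}" and t: "0 \<le> t" "t \<le> 1"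
  shows "t\<^sup>2 * (1 - t) \<le> subset_expect t I (\<lambda>X. of_bool (robust U (SR \<union> X)))"
proof -
  have ne: "U \<noteq> {}" using U(2) by auto
  have finI: "finite I" using I finite_E finite_subset by blast
  let ?hit_edge = "\<lambda>X. hit_edge U (SR \<union> X)" and ?fst = "\<lambda>X. first_hit U (SR \<union> X)"
  have dis: "SR \<inter> I = {}" using SR(2) I(2) by blast
  have arcI: "c \<in> X" if X: "X \<subseteq> I" "?hit_edge X = Some c" for c X
  proof -
    have "SR \<union> X \<subseteq> E" using X SR I by auto
    then obtain a where "c \<in> SR \<union> X" "ends c = {a, ?fst X}" "?fst X \<in> U"
      by (rule hit_edge_SomeD[OF _ U(1) ne X(2)])
    then show ?thesis using SR(2) by auto
  qed
  have rem: "?hit_edge Y = ?hit_edge X" "?fst Y = ?fst X"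
    if "X \<subseteq> I" "Y \<subseteq> X" "\<And>c. ?hit_edge X = Some c \<Longrightarrow> c \<in> Y" for X Y
  proof -
    have "hit_edge U (SR \<union> Y) = hit_edge U (SR \<union> X) \<and> first_hit U (SR \<union> Y) = first_hit U (SR \<union> X)"
      by (intro conjI remove_incident(2,3)) (use that SR I U ne in auto)
    then show "?hit_edge Y = ?hit_edge X" "?fst Y = ?fst X" by auto
  qed
  have robI: "robust U (SR \<union> X)" if "X \<subseteq> I" "\<And>c. ?hit_edge X = Some c \<Longrightarrow> ?fst (X - {c}) = ?fst X" for X
    unfolding robust_def
  proof (intro allI impI)
    fix c assume c: "hit_edge U (SR \<union> X) = Some c"
    have "c \<in> X" using arcI[OF that(1) c] .
    then have "SR \<union> X - {c} = SR \<union> (X - {c})" using dis that(1) by auto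
    then show "first_hit U (SR \<union> X - {c}) = first_hit U (SR \<union> X)" using that(2)[OF c] by simp
  qed
  have main: "t ^ card P * (1 - t) ^ card N \<le> subset_expect t I (\<lambda>X. of_bool (robust U (SR \<union> X)))"
    if "P \<subseteq> I" "N \<subseteq> I" "P \<inter> N = {}" "\<And>X. X \<subseteq> I \<Longrightarrow> P \<subseteq> X \<Longrightarrow> X \<inter> N = {} \<Longrightarrow> robust U (SR \<union> X)" for P N
    by (rule subset_expect_lower_on) (use that t finI in auto)
  have tt: "t\<^sup>2 * (1 - t) \<le> 1 - t" "t\<^sup>2 * (1 - t) \<le> t\<^sup>2" "t\<^sup>2 * (1 - t) \<le> t * (1 - t)" "t\<^sup>2 * (1 - t) \<le> 1"
  proof -
    have sq: "t\<^sup>2 \<le> t" "t\<^sup>2 \<le> 1" "0 \<le> t\<^sup>2"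
      using t mult_left_mono[of t 1 t] by (simp_all add: power2_eq_square mult_le_one)
    show "t\<^sup>2 * (1 - t) \<le> 1 - t" using mult_right_mono[OF sq(2), of "1 - t"] t by simp
    show "t\<^sup>2 * (1 - t) \<le> t * (1 - t)" using mult_right_mono[OF sq(1), of "1 - t"] t by simp
    show *: "t\<^sup>2 * (1 - t) \<le> t\<^sup>2" using mult_left_mono[of "1 - t" 1 "t\<^sup>2"] t by simp
    show "t\<^sup>2 * (1 - t) \<le> 1" using * sq(2) by linarith
  qed
  show ?thesis
  proof (cases "?hit_edge I")
    case None
    have "robust U (SR \<union> X)" if "X \<subseteq> I" for X
    proof -
      have "?hit_edge X = None" using rem(1)[OF order_refl that] None by simp
      then show ?thesis using robI[OF that] by simp
    qed
    then have "1 \<le> subset_expect t I (\<lambda>X. of_bool (robust U (SR \<union> X)))"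
      by (intro subset_expect_lower) (use finI t in auto)
    then show ?thesis using tt by linarith
  next
    case (Some c1)
    have c1: "c1 \<in> I" using arcI[OF order_refl Some] .
    define I1 where "I1 = I - {c1}"
    have I1: "I1 \<subseteq> I" by (auto simp: I1_def)
    show ?thesis
    proof (cases "?hit_edge I1")
      case None
      \<comment> \<open>With \<open>c1\<close> absent every \<open>X\<close> is entered by a
        jump.\<close>
      have "t ^ card ({} :: 'e set) * (1 - t) ^ card {c1} \<le> subset_expect t I (\<lambda>X. of_bool (robust U (SR \<union> X)))"
      proof (rule main[of "{}" "{c1}"])
        fix X assume "X \<subseteq> I" "X \<inter> {c1} = {}"
        then have "X \<subseteq> I1" by (auto simp: I1_def)
        then have "?hit_edge X = None" using rem(1)[OF I1] None by simp
        then show "robust U (SR \<union> X)" using robI[OF \<open>X \<subseteq> I\<close>] by simp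
      qed (use c1 in auto)
      then show ?thesis using tt by simp
    next
      case (Some c2)
      have c2: "c2 \<in> I" "c2 \<noteq> c1" using arcI[OF I1 Some] by (auto simp: I1_def)
      define I2 where "I2 = I1 - {c2}"
      have I2: "I2 \<subseteq> I" by (auto simp: I2_def I1_def)
      note a1 = \<open>?hit_edge I = Some c1\<close> and a2 = \<open>?hit_edge I1 = Some c2\<close>
      have f: "?fst I \<in> U" "?fst I1 \<in> U" "?fst I2 \<in> U"
        by (rule hit_step_props(1); use SR I I1 I2 U ne in auto)+
      have fcases: "?fst I = ?fst I1 \<or> ?fst I2 = ?fst I \<or> ?fst I2 = ?fst I1"
        using f U(2) by (auto simp: card_2_iff)
      \<comment> \<open>\<open>N3\<close> holds the third best edge. It is empty if the run on
        \<open>SR \<union> I2\<close> jumps into \<open>U\<close>, which saves a factor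
        \<open>t\<close>.\<close>
      define N3 where "N3 = (case ?hit_edge I2 of None \<Rightarrow> {} | Some c \<Rightarrow> {c})"
      have N3: "N3 \<subseteq> I2" "\<And>c. ?hit_edge I2 = Some c \<Longrightarrow> c \<in> N3"
        using arcI[OF I2] by (auto simp: N3_def split: option.splits)
      have N3c: "c1 \<notin> N3" "c2 \<notin> N3" using N3(1) by (auto simp: I2_def I1_def)
      have cardN3: "t ^ Suc (card N3) * (1 - t) \<ge> t\<^sup>2 * (1 - t)"
        using tt(3) by (cases "?hit_edge I2") (auto simp: N3_def power2_eq_square)
      have finN3: "finite N3" by (auto simp: N3_def split: option.splits)
      consider "?fst I = ?fst I1" | "?fst I2 = ?fst I" | "?fst I2 = ?fst I1" using fcases by blast
      then show ?thesis
      proof cases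
        case 1
        have "t ^ card {c1, c2} * (1 - t) ^ card ({} :: 'e set) \<le> subset_expect t I (\<lambda>X. of_bool (robust U (SR \<union> X)))"
        proof (rule main[of "{c1, c2}" "{}"])
          fix X assume X: "X \<subseteq> I" "{c1, c2} \<subseteq> X"
          have 2: "?hit_edge X = Some c1" "?fst X = ?fst I" using rem[of I X] X a1 by auto
          have "?fst (X - {c1}) = ?fst I1"
            using X c2 a2 by (intro rem(2)[OF I1]) (auto simp: I1_def)
          then show "robust U (SR \<union> X)" using 1 2 X by (intro robI) auto
        qed (use c1 c2 in auto)
        then show ?thesis using tt c2 by (simp add: power2_eq_square)
      next
        case 2
        have "t ^ card (insert c1 N3) * (1 - t) ^ card {c2} \<le> subset_expect t I (\<lambda>X. of_bool (robust U (SR \<union> X)))"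
        proof (rule main)
          fix X assume X: "X \<subseteq> I" "insert c1 N3 \<subseteq> X" "X \<inter> {c2} = {}"
          have 3: "?hit_edge X = Some c1" "?fst X = ?fst I" using rem[of I X] X a1 by auto
          have "?fst (X - {c1}) = ?fst I2"
            using X N3(2) N3c by (intro rem(2)[OF I2]) (auto simp: I1_def I2_def)
          then show "robust U (SR \<union> X)" using 2 3 X by (intro robI) auto
        qed (use c1 c2 N3(1) I2 N3c in auto)
        then show ?thesis using cardN3 N3c finN3 by simp
      next
        case 3
        have "t ^ card (insert c2 N3) * (1 - t) ^ card {c1} \<le> subset_expect t I (\<lambda>X. of_bool (robust U (SR \<union> X)))"
        proof (rule main)
          fix X assume X: "X \<subseteq> I" "insert c2 N3 \<subseteq> X" "X \<inter> {c1} = {}"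
          then have XI1: "X \<subseteq> I1" by (auto simp: I1_def)
          have 4: "?hit_edge X = Some c2" "?fst X = ?fst I1" using rem[OF I1 XI1] X a2 by auto
          have "?fst (X - {c2}) = ?fst I2"
            using X XI1 N3(2) N3c by (intro rem(2)[OF I2]) (auto simp: I2_def)
          then show "robust U (SR \<union> X)" using 3 4 X by (intro robI) auto
        qed (use c1 c2 N3(1) I2 N3c in auto)
        then show ?thesis using cardN3 N3c finN3 by simp
      qed
    qed
  qed
qed

text \<open>For fixed \<open>XR\<close> and \<open>SR\<close> the bound of
  \<open>accept_prob_first\<close> is averaged over the arrivals at the ends of \<open>e\<close>.
  This works because robustness of \<open>SR \<union> XI\<close> looks at which edges of
  \<open>I\<close> have arrived, not at which of them are sampled.\<close>

lemma accept_prob_at_time: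
  assumes e: "e \<in> max_forest" and t: "0 \<le> t" "t \<le> 1" and q: "0 \<le> q" "q \<le> 1"
  shows "q\<^sup>2 * (1 + (1 - q) * (t\<^sup>2 * (1 - t)))
    \<le> subset_expect t (E - {e}) (\<lambda>X. subset_expect q X (\<lambda>A. of_bool (accepts A (X - A) e)))"
proof -
  have eE: "e \<in> E" using e by (simp add: max_forest_def)
  define U where "U = ends e"
  have U: "U \<subseteq> V" "card U = 2" using ends_subset[OF eE] card_ends[OF eE] by (auto simp: U_def)
  define R where "R = {g \<in> E - {e}. ends g \<inter> U = {}}"
  define I where "I = {g \<in> E - {e}. ends g \<inter> U \<noteq> {} \<and> \<not> U \<subseteq> ends g}"
  define P where "P = {g \<in> E - {e}. U \<subseteq> ends g}"
  have Une: "U \<noteq> {}" using U by auto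
  have RIP: "E - {e} = R \<union> (I \<union> P)" "R \<inter> (I \<union> P) = {}" "I \<inter> P = {}"
    using Une by (auto simp: R_def I_def P_def)
  have fin: "finite R" "finite I" "finite P" using finite_E by (auto simp: R_def I_def P_def)
  let ?F = "\<lambda>X A. of_bool (accepts A (X - A) e) :: real"
  have inner: "q\<^sup>2 * (1 + (1 - q) * (t\<^sup>2 * (1 - t)))
      \<le> subset_expect t (I \<union> P) (\<lambda>Y. subset_expect q Y (\<lambda>A. ?F (XR \<union> Y) (SR \<union> A)))"
    if XR: "XR \<subseteq> R" and SR: "SR \<subseteq> XR" for XR SR
  proof -
    have step: "q * (q + (if robust U (SR \<union> XI) then q * (1 - q) else 0))
        \<le> subset_expect q (XI \<union> XP) (\<lambda>A. ?F (XR \<union> (XI \<union> XP)) (SR \<union> A))" if X: "XI \<subseteq> I" "XP \<subseteq> P" for XI XP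
    proof -
      have "SR \<union> XI \<subseteq> E" using X XR SR by (auto simp: R_def I_def)
      then have "first_hit U (SR \<union> XI) \<in> U" by (rule hit_step_props(1)[OF _ U(1) Une])
      \<comment> \<open>The argument is symmetric in the ends of \<open>e\<close>; the one entered
        first is named \<open>u\<close>.\<close>
      then obtain u v where uv: "U = {u, v}" "first_hit U (SR \<union> XI) = u" "u \<noteq> v"
      proof -
        obtain a b where ab: "U = {a, b}" "a \<noteq> b" using U(2) by (auto simp: card_2_iff)
        show thesis
        proof (cases "first_hit U (SR \<union> XI) = a")
          case True then show ?thesis using that[of a b] ab by simp
        next
          case False
          then have "first_hit U (SR \<union> XI) = b" using ab \<open>first_hit U (SR \<union> XI) \<in> U\<close> by blast
          then show ?thesis using that[of b a] ab by (simp add: insert_commute)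
        qed
      qed
      show ?thesis
        unfolding uv(1)
        by (rule accept_prob_first[OF e])
          (use uv q SR XR X in \<open>auto simp: R_def I_def P_def U_def[symmetric]\<close>)
    qed
    have "t\<^sup>2 * (1 - t) \<le> subset_expect t I (\<lambda>X. of_bool (robust U (SR \<union> X)))"
      by (rule robust_prob[OF U]) (use SR XR t in \<open>auto simp: R_def I_def\<close>)
    then have "q\<^sup>2 * (1 - q) * (t\<^sup>2 * (1 - t)) \<le> q\<^sup>2 * (1 - q) * subset_expect t I (\<lambda>X. of_bool (robust U (SR \<union> X)))"
      using q by (intro mult_left_mono) auto
    then have "q\<^sup>2 * (1 + (1 - q) * (t\<^sup>2 * (1 - t))) \<le>
        q\<^sup>2 + q\<^sup>2 * (1 - q) * subset_expect t I (\<lambda>X. of_bool (robust U (SR \<union> X)))"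
      by (simp add: algebra_simps)
    also have "\<dots> = subset_expect t I (\<lambda>X. q * (q + (if robust U (SR \<union> X) then q * (1 - q) else 0)))"
    proof -
      have "subset_expect t I (\<lambda>X. q * (q + (if robust U (SR \<union> X) then q * (1 - q) else 0)))
          = subset_expect t I (\<lambda>X. q\<^sup>2 + q\<^sup>2 * (1 - q) * of_bool (robust U (SR \<union> X)))"
        by (rule subset_expect_cong) (auto simp: power2_eq_square algebra_simps)
      then show ?thesis using fin by (simp add: subset_expect_add subset_expect_cmult)
    qed
    also have "\<dots> \<le> subset_expect t I (\<lambda>XI. subset_expect t P (\<lambda>XP. subset_expect q (XI \<union> XP) (\<lambda>A. ?F (XR \<union> (XI \<union> XP)) (SR \<union> A))))"
      by (intro subset_expect_mono subset_expect_lower step t fin)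
    also have "\<dots> = subset_expect t (I \<union> P) (\<lambda>Y. subset_expect q Y (\<lambda>A. ?F (XR \<union> Y) (SR \<union> A)))"
      using fin RIP by (subst subset_expect_union) auto
    finally show ?thesis .
  qed
  have "q\<^sup>2 * (1 + (1 - q) * (t\<^sup>2 * (1 - t))) \<le> subset_expect t R (\<lambda>XR. subset_expect q XR (\<lambda>SR.
      subset_expect t (I \<union> P) (\<lambda>Y. subset_expect q Y (\<lambda>A. ?F (XR \<union> Y) (SR \<union> A)))))"
    by (intro subset_expect_lower inner t q fin) (auto intro: finite_subset fin)
  \<comment> \<open>Sampling away from \<open>e\<close> and arrivals near \<open>e\<close> are
    independent, so the two averages may be exchanged and merged into one over all of
    \<open>E - {e}\<close>.\<close>
  also have "\<dots> = subset_expect t R (\<lambda>XR. subset_expect t (I \<union> P) (\<lambda>Y. subset_expect q (XR \<union> Y) (?F (XR \<union> Y))))"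
  proof (rule subset_expect_cong)
    fix XR assume XR: "XR \<subseteq> R"
    have "subset_expect q XR (\<lambda>SR. subset_expect t (I \<union> P) (\<lambda>Y. subset_expect q Y (\<lambda>A. ?F (XR \<union> Y) (SR \<union> A)))) =
      subset_expect t (I \<union> P) (\<lambda>Y. subset_expect q XR (\<lambda>SR. subset_expect q Y (\<lambda>A. ?F (XR \<union> Y) (SR \<union> A))))"
      by (rule subset_expect_swap)
    also have "\<dots> = subset_expect t (I \<union> P) (\<lambda>Y. subset_expect q (XR \<union> Y) (?F (XR \<union> Y)))"
    proof (rule subset_expect_cong)
      fix Y assume "Y \<subseteq> I \<union> P"
      then show "subset_expect q XR (\<lambda>SR. subset_expect q Y (\<lambda>A. ?F (XR \<union> Y) (SR \<union> A))) = subset_expect q (XR \<union> Y) (?F (XR \<union> Y))"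
        using XR RIP fin by (subst subset_expect_union) (auto intro: finite_subset)
    qed
    finally show "subset_expect q XR (\<lambda>SR. subset_expect t (I \<union> P) (\<lambda>Y. subset_expect q Y (\<lambda>A. ?F (XR \<union> Y) (SR \<union> A)))) =
        subset_expect t (I \<union> P) (\<lambda>Y. subset_expect q (XR \<union> Y) (?F (XR \<union> Y)))" .
  qed
  also have "\<dots> = subset_expect t (E - {e}) (\<lambda>X. subset_expect q X (?F X))"
    unfolding RIP(1) using fin RIP by (subst subset_expect_union) auto
  finally show ?thesis .
qed

end

section \<open>Optimality of the maximum spanning forest\<close>

lemma conn_insert_iff:
  assumes "ends g = {x, y}"
  shows "conn ends (insert g S) a b \<longleftrightarrow>
    conn ends S a b \<or> conn ends S a x \<and> conn ends S y b \<or> conn ends S a y \<and> conn ends S x b"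
    (is "?L \<longleftrightarrow> ?R b")
proof
  assume ?L
  then show "?R b"
    unfolding conn_def[of ends "insert g S"]
  proof (induction rule: rtranclp_induct)
    case (step b c)
    then obtain h where h: "h \<in> insert g S" "ends h = {b, c}" by (auto simp: adj_def)
    show ?case
    proof (cases "h \<in> S")
      case True
      then have "conn ends S b c" using h by (auto intro: conn_edge)
      then show ?thesis using step.IH conn_trans[of ends S _ b c] by blast
    next
      case False
      then have "{b, c} = {x, y}" using h assms by auto
      then have "b = x \<and> c = y \<or> b = y \<and> c = x" by (auto simp: doubleton_eq_iff)
      then show ?thesis using step.IH conn_sym[of ends S] conn_trans[of ends S] conn_refl[of ends S] by metis
    qed
  qed simp
next
  assume R: "?R b"
  have m: "conn ends (insert g S) p q" if "conn ends S p q" for p q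
    using conn_mono[OF _ that] by blast
  have "conn ends (insert g S) x y" by (rule conn_edge[of g]) (use assms in auto)
  then show ?L using R m conn_trans[of ends "insert g S"] conn_sym[of ends "insert g S"] by meson
qed

text \<open>The least vertex of each component, so the cardinality is the number of
  components.\<close>

definition reps :: "nat set \<Rightarrow> ('e \<Rightarrow> nat set) \<Rightarrow> 'e set \<Rightarrow> nat set" where
  "reps V ends S = {x \<in> V. \<forall>y\<in>V. conn ends S x y \<longrightarrow> x \<le> y}"

lemma finite_reps: "finite V \<Longrightarrow> finite (reps V ends S)"
  by (simp add: reps_def)

lemma reps_antimono: "S \<subseteq> T \<Longrightarrow> reps V ends T \<subseteq> reps V ends S"
  by (auto simp: reps_def intro: conn_mono)

lemma reps_empty: "reps V ends {} = V"
proof -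
  have "conn ends {} x y \<Longrightarrow> x = y" for x y
    unfolding conn_def by (induction rule: rtranclp_induct) (auto simp: adj_def)
  then show ?thesis by (auto simp: reps_def)
qed

lemma ex_rep:
  assumes "finite V" "x \<in> V"
  obtains r where "r \<in> reps V ends S" "conn ends S x r"
proof -
  define C where "C = {y \<in> V. conn ends S x y}"
  have C: "finite C" "x \<in> C" using assms by (auto simp: C_def)
  define r where "r = Min C"
  have r: "r \<in> C" "\<And>y. y \<in> C \<Longrightarrow> r \<le> y" using C by (auto simp: r_def intro: Min_in)
  have "r \<le> y" if "y \<in> V" "conn ends S r y" for y
    using r(2)[of y] r(1) that conn_trans[of ends S x r y] by (simp add: C_def)
  then show thesis using that[of r] r(1) by (simp add: reps_def C_def)
qed

lemma reps_eq:
  assumes "r \<in> reps V ends S" "r' \<in> reps V ends S" "conn ends S r r'"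
  shows "r = r'"
  using assms conn_sym[OF assms(3)] by (force simp: reps_def)

lemma reps_insert_conn:
  assumes "ends g = {x, y}" "conn ends S x y"
  shows "reps V ends (insert g S) = reps V ends S"
proof -
  have "conn ends (insert g S) a b \<longleftrightarrow> conn ends S a b" for a b
    unfolding conn_insert_iff[of ends g x y S a b, OF assms(1)]
    using assms(2) conn_trans[of ends S] conn_sym[of ends S] by meson
  then show ?thesis by (simp add: reps_def)
qed

text \<open>The new edge merges two components, and of their two least vertices only the smaller one
  remains a representative.\<close>

lemma card_reps_insert:
  assumes V: "finite V" and g: "ends g = {x, y}" "x \<in> V" "y \<in> V" and n: "\<not> conn ends S x y"
  shows "card (reps V ends S) = Suc (card (reps V ends (insert g S)))"
proof -
  obtain p where p: "p \<in> reps V ends S" "conn ends S x p" by (rule ex_rep[OF V g(2)])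
  obtain q where q: "q \<in> reps V ends S" "conn ends S y q" by (rule ex_rep[OF V g(3)])
  have pq: "p \<noteq> q" using p q n conn_trans[of ends S x p y] conn_sym[of ends S y p] by metis
  \<comment> \<open>The ends are kept variable so that both \<open>p < q\<close> and
    \<open>q < p\<close> are covered.\<close>
  have *: "reps V ends (insert h S) = reps V ends S - {b}"
    if h: "ends h = {u, v}" and ab: "a \<in> reps V ends S" "conn ends S u a" "b \<in> reps V ends S" "conn ends S v b" "a < b"
    for h u v a b
  proof (rule set_eqI, rule iffI)
    fix z assume z: "z \<in> reps V ends (insert h S)"
    have "conn ends (insert h S) b a"
      unfolding conn_insert_iff[of ends h u v S b a, OF h] using ab conn_sym[of ends S] by blast
    then have "z \<noteq> b" using z ab by (force simp: reps_def)
    then show "z \<in> reps V ends S - {b}" using z reps_antimono[of S "insert h S" V ends] by blast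
  next
    fix z assume z: "z \<in> reps V ends S - {b}"
    have "z \<le> w" if w: "w \<in> V" "conn ends (insert h S) z w" for w
    proof -
      consider "conn ends S z w" | "conn ends S z u" "conn ends S v w" | "conn ends S z v" "conn ends S u w"
        using w(2) unfolding conn_insert_iff[of ends h u v S z w, OF h] by blast
      then show ?thesis
      proof cases
        case 1 then show ?thesis using z w by (simp add: reps_def)
      next
        case 2
        have "z = a" by (rule reps_eq[of _ V ends S]) (use z ab conn_trans[OF 2(1) ab(2)] in auto)
        moreover have "b \<le> w" using ab(3) w(1) conn_trans[OF conn_sym[OF ab(4)] 2(2)] by (simp add: reps_def)
        ultimately show ?thesis using ab(5) by simp
      next
        case 3
        have "z = b" by (rule reps_eq[of _ V ends S]) (use z ab conn_trans[OF 3(1) ab(4)] in auto)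
        then show ?thesis using z by simp
      qed
    qed
    then show "z \<in> reps V ends (insert h S)" using z by (simp add: reps_def)
  qed
  have "\<exists>b\<in>reps V ends S. reps V ends (insert g S) = reps V ends S - {b}"
  proof (cases "p < q")
    case True
    then show ?thesis using *[OF g(1) p q True] q by blast
  next
    case False
    then have "q < p" using pq by simp
    moreover have "ends g = {y, x}" using g by auto
    ultimately show ?thesis using *[of g y x q p] p q by blast
  qed
  then show ?thesis
    using finite_reps[OF V, of ends S] by (metis card_Suc_Diff1)
qed

text \<open>Starting from isolated vertices, each added forest edge merges two components. All
  subsets \<open>G\<close> are covered because the forest will be cut down to its best
  edges.\<close>

lemma card_forest:
  assumes V: "finite V" and F: "finite F" "\<And>g. g \<in> F \<Longrightarrow> ends g \<subseteq> V \<and> card (ends g) = 2"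
    and forest: "\<And>g x y. g \<in> F \<Longrightarrow> ends g = {x, y} \<Longrightarrow> \<not> conn ends (F - {g}) x y"
  shows "G \<subseteq> F \<Longrightarrow> card G + card (reps V ends G) = card V"
proof -
  assume GF: "G \<subseteq> F"
  then have "finite G" using F(1) finite_subset by blast
  then show ?thesis using GF
  proof (induction G rule: finite_induct)
    case empty then show ?case by (simp add: reps_empty)
  next
    case (insert g G)
    then have gF: "g \<in> F" by simp
    obtain x y where xy: "ends g = {x, y}" using F(2)[OF gF] by (auto simp: card_2_iff)
    have "G \<subseteq> F - {g}" using insert by auto
    then have "\<not> conn ends G x y" using forest[OF gF xy] conn_mono by blast
    then have "card (reps V ends G) = Suc (card (reps V ends (insert g G)))"
      using F(2)[OF gF] xy by (intro card_reps_insert[OF V, where x = x and y = y]) auto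
    then show ?case using insert by simp
  qed
qed

section \<open>Greedy optimality by comparison on initial segments of the ranking\<close>

context prim
begin

definition upset :: "'e set \<Rightarrow> bool" where
  "upset P \<longleftrightarrow> P \<subseteq> E \<and> (\<forall>g\<in>P. \<forall>h\<in>E. h \<succ> g \<longrightarrow> h \<in> P)"

text \<open>The last edge of a nonempty initial segment is its worst one, and the rest of the
  segment consists of exactly the edges that beat it.\<close>

lemma upset_induct [consumes 1, case_names empty step]:
  assumes "upset P"
    and empty: "Q {}"
    and step: "\<And>P g. P \<subseteq> E \<Longrightarrow> g \<in> E \<Longrightarrow> g \<notin> P \<Longrightarrow> P = {h \<in> E. h \<succ> g} \<Longrightarrow> Q P \<Longrightarrow> Q (insert g P)"
  shows "Q P"
  using assms(1)
proof (induction "card P" arbitrary: P)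
  case 0
  then show ?case using finite_sub empty by (simp add: upset_def)
next
  case (Suc n)
  \<comment> \<open>In the reversed order \<open>finite_best\<close> provides a worst edge.\<close>
  interpret rev: prim V E ends "\<lambda>g h. h \<succ> g"
    by unfold_locales
      (use finite_V finite_E ends_subset card_ends better_irrefl better_trans better_total in blast)+
  have "finite P" "P \<noteq> {}" using Suc finite_sub by (auto simp: upset_def)
  then obtain g where g: "g \<in> P" "\<And>h. h \<in> P \<Longrightarrow> h \<noteq> g \<Longrightarrow> h \<succ> g"
    using rev.finite_best[of P] Suc.prems by (auto simp: upset_def)
  define P' where "P' = P - {g}"
  have P': "P' = {h \<in> E. h \<succ> g}"
    using g Suc.prems better_irrefl by (auto simp: P'_def upset_def)
  have "Q P'"
  proof (rule Suc.hyps(1))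
    show "n = card P'" using Suc.hyps(2) g(1) \<open>finite P\<close> by (simp add: P'_def)
    show "upset P'"
      unfolding upset_def P' by (auto intro: better_trans)
  qed
  then have "Q (insert g P')"
    by (intro step) (use Suc.prems g P' in \<open>auto simp: P'_def upset_def\<close>)
  then show ?case using g(1) by (simp add: P'_def insert_absorb)
qed

text \<open>An edge enters \<open>max_forest\<close> exactly when it joins two components of the
  edges better than it, so on each segment the forest has one edge per merger.\<close>

lemma card_max_forest_upset:
  assumes "upset P"
  shows "card (max_forest \<inter> P) + card (reps V ends P) = card V"
  using assms
proof (induction P rule: upset_induct)
  case empty
  then show ?case by (simp add: reps_empty)
next
  case (step P g)
  have fin: "finite (max_forest \<inter> P)" using step finite_sub by auto
  obtain x y where xy: "ends g = {x, y}" "x \<in> V" "y \<in> V" using ends_pair[OF step(2)] by metis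
  have "g \<in> max_forest \<longleftrightarrow> \<not> conn ends P x y"
    unfolding max_forest_def using step(2,4) xy conn_sym[of ends P] by (auto simp: doubleton_eq_iff)
  then show ?case
    using step fin card_reps_insert[where ends = ends and g = g, OF finite_V xy, of P]
      reps_insert_conn[where ends = ends and g = g, OF xy(1), of P V]
    by (cases "g \<in> max_forest") auto
qed

text \<open>On every initial segment \<open>max_forest\<close> has at least as many edges as
  \<open>F\<close>, since a subset of the segment has at least as many components as the segment.
  Summation by parts turns this into a comparison of weights.\<close>

lemma max_forest_optimal:
  assumes wt: "\<And>g. g \<in> E \<Longrightarrow> 0 \<le> (wt g :: real)" "\<And>g h. g \<in> E \<Longrightarrow> h \<in> E \<Longrightarrow> g \<succ> h \<Longrightarrow> wt h \<le> wt g"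
    and F: "F \<subseteq> E" "\<And>g x y. g \<in> F \<Longrightarrow> ends g = {x, y} \<Longrightarrow> \<not> conn ends (F - {g}) x y"
  shows "sum wt F \<le> sum wt max_forest"
proof -
  let ?d = "\<lambda>P. real (card (max_forest \<inter> P)) - real (card (F \<inter> P))"
  have up: "card (F \<inter> P) \<le> card (max_forest \<inter> P)"
    if "upset P" for P
  proof -
    have "card (F \<inter> P) + card (reps V ends (F \<inter> P)) = card V"
    proof (rule card_forest[OF finite_V, of F])
      show "finite F" by (rule finite_sub[OF F(1)])
      show "ends g \<subseteq> V \<and> card (ends g) = 2" if "g \<in> F" for g
        using that F(1) ends_subset card_ends by blast
    qed (use F in auto)
    moreover have "card (reps V ends P) \<le> card (reps V ends (F \<inter> P))"
      by (intro card_mono finite_reps finite_V reps_antimono) auto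
    ultimately show ?thesis using card_max_forest_upset[OF that] by linarith
  qed
  \<comment> \<open>The lower bound \<open>c\<close> on the weights carries the summation by parts:
    for \<open>c = wt g\<close>, adding \<open>g\<close> changes both sides equally, and afterwards
    \<open>c\<close> may be lowered because \<open>?d\<close> is nonnegative.\<close>
  have "c * ?d P \<le> sum wt (max_forest \<inter> P) - sum wt (F \<inter> P)"
    if "upset P" "\<And>g. g \<in> P \<Longrightarrow> c \<le> wt g" for P c
    using that
  proof (induction P arbitrary: c rule: upset_induct)
    case (step P g)
    have "g \<in> E" "finite P" using step finite_sub by auto
    have "wt g * ?d P \<le> sum wt (max_forest \<inter> P) - sum wt (F \<inter> P)"
      by (rule step.IH) (use step wt(2) in auto)
    then have "wt g * ?d (insert g P) \<le> sum wt (max_forest \<inter> insert g P) - sum wt (F \<inter> insert g P)"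
      using \<open>finite P\<close> step(3) by (auto simp: Int_insert_right algebra_simps)
    moreover have "0 \<le> ?d (insert g P)"
    proof -
      have "card (F \<inter> insert g P) \<le> card (max_forest \<inter> insert g P)"
        by (rule up) (use step in \<open>auto simp: upset_def intro: better_trans\<close>)
      then show ?thesis by simp
    qed
    ultimately show ?case
      using step.prems[of g] mult_right_mono[of c "wt g" "?d (insert g P)"] by simp
  qed simp
  from this[of E 0] have "0 \<le> sum wt (max_forest \<inter> E) - sum wt (F \<inter> E)" using wt by (auto simp: upset_def)
  moreover have "max_forest \<inter> E = max_forest" "F \<inter> E = F" using F by (auto simp: max_forest_def)
  ultimately show ?thesis by simp
qed

end

section \<open>Simple paths and cycles\<close>

lemma conn_path:
  assumes "conn ends S x y"
  shows "\<exists>vs es. vs \<noteq> [] \<and> hd vs = x \<and> last vs = y \<and> distinct vs \<and> length vs = Suc (length es) \<and>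
    (\<forall>i<length es. es ! i \<in> S \<and> ends (es ! i) = {vs ! i, vs ! Suc i})"
  using assms unfolding conn_def
proof (induction rule: rtranclp_induct)
  case base
  show ?case by (rule exI[of _ "[x]"], rule exI[of _ "[]"]) simp
next
  case (step y z)
  then obtain vs es where p: "vs \<noteq> []" "hd vs = x" "last vs = y" "distinct vs" "length vs = Suc (length es)"
    "\<And>i. i < length es \<Longrightarrow> es ! i \<in> S \<and> ends (es ! i) = {vs ! i, vs ! Suc i}" by blast
  from step(2) obtain g where g: "g \<in> S" "ends g = {y, z}" by (auto simp: adj_def)
  show ?case
  proof (cases "z \<in> set vs")
    case False
    have "vs ! length es = y" using p by (simp add: last_conv_nth)
    then have "\<forall>i<length (es @ [g]). (es @ [g]) ! i \<in> S \<and>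
        ends ((es @ [g]) ! i) = {(vs @ [z]) ! i, (vs @ [z]) ! Suc i}"
      using p g by (auto simp: nth_append less_Suc_eq)
    then show ?thesis
      by (intro exI[of _ "vs @ [z]"] exI[of _ "es @ [g]"]) (use p False in auto)
  next
    case True
    \<comment> \<open>The new vertex is already on the path, which is therefore cut off
      there.\<close>
    then obtain k where k: "k < length vs" "vs ! k = z" by (auto simp: in_set_conv_nth)
    have "last (take (Suc k) vs) = z" using k by (simp add: take_Suc_conv_app_nth)
    moreover have "\<forall>i<length (take k es). take k es ! i \<in> S \<and>
        ends (take k es ! i) = {take (Suc k) vs ! i, take (Suc k) vs ! Suc i}"
      using p by auto
    ultimately show ?thesis
      by (intro exI[of _ "take (Suc k) vs"] exI[of _ "take k es"]) (use p k in \<open>auto simp: hd_take\<close>)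
  qed
qed

text \<open>A simple path between the ends of \<open>f\<close> closes up with \<open>f\<close> to a
  cycle. Its edges are distinct because different positions on a simple path have different end
  sets.\<close>

lemma acyclic_edges_not_conn:
  assumes ac: "acyclic_edges ends F" and f: "f \<in> F" "ends f = {x, y}" "x \<noteq> y"
  shows "\<not> conn ends (F - {f}) x y"
proof
  assume "conn ends (F - {f}) x y"
  then obtain vs es where p: "vs \<noteq> []" "hd vs = x" "last vs = y" "distinct vs" "length vs = Suc (length es)"
    "\<And>i. i < length es \<Longrightarrow> es ! i \<in> F - {f} \<and> ends (es ! i) = {vs ! i, vs ! Suc i}"
    by (blast dest: conn_path)
  have ends_nth: "vs ! 0 = x" "vs ! length es = y"
    using p by (auto simp: hd_conv_nth last_conv_nth)
  have "distinct es"
    unfolding distinct_conv_nth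
  proof (intro allI impI)
    fix i j assume ij: "i < length es" "j < length es" "i \<noteq> j"
    have "{vs ! i, vs ! Suc i} \<noteq> {vs ! j, vs ! Suc j}"
      using ij p(4,5) by (auto simp: doubleton_eq_iff nth_eq_iff_index_eq)
    then show "es ! i \<noteq> es ! j" using p(6) ij by metis
  qed
  moreover have "set es \<subseteq> F - {f}"
  proof
    fix g assume "g \<in> set es"
    then obtain i where "i < length es" "es ! i = g" by (auto simp: in_set_conv_nth)
    then show "g \<in> F - {f}" using p(6)[of i] by blast
  qed
  moreover have "ends ((es @ [f]) ! i) = {vs ! i, vs ! ((i + 1) mod length (es @ [f]))}"
    if "i < length (es @ [f])" for i
  proof (cases "i = length es")
    case True then show ?thesis using ends_nth f by auto
  next
    case False then show ?thesis using that p(6)[of i] by (simp add: nth_append)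
  qed
  ultimately have "is_cycle ends (es @ [f]) vs" "set (es @ [f]) \<subseteq> F"
    using p f by (auto simp: is_cycle_def)
  then show False using ac by (auto simp: acyclic_edges_def)
qed

section \<open>Random arrival orders\<close>

lemma DERIV_shifted_powers:
  "((\<lambda>t::real. (t - a) ^ Suc b) has_real_derivative real (Suc b) * (t - a) ^ b) (at t within S)"
  "((\<lambda>t::real. (a - t) ^ Suc b) has_real_derivative - real (Suc b) * (a - t) ^ b) (at t within S)"
proof -
  have "((\<lambda>t. t - a) has_real_derivative 1) (at t within S)"
    "((\<lambda>t. a - t) has_real_derivative -1) (at t within S)"
    by (auto intro!: derivative_eq_intros)
  from this[THEN DERIV_power_Suc[of _ _ _ _ b]]
  show "((\<lambda>t::real. (t - a) ^ Suc b) has_real_derivative real (Suc b) * (t - a) ^ b) (at t within S)"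
    "((\<lambda>t::real. (a - t) ^ Suc b) has_real_derivative - real (Suc b) * (a - t) ^ b) (at t within S)"
    by (simp_all add: algebra_simps)
qed

text \<open>A Beta integral on the interval from 1/2 to 1. Integration by parts trades one factor
  \<open>1 - t\<close> for one factor \<open>t - 1/2\<close>.\<close>

lemma beta_integral:
  "((\<lambda>t::real. (t - 1/2) ^ b * (1 - t) ^ c) has_integral
     (1/2) ^ (b + c + 1) * fact b * fact c / fact (b + c + 1)) {1/2..1}"
proof (induction c arbitrary: b)
  case 0
  let ?F = "\<lambda>t::real. (t - 1/2) ^ Suc b / real (Suc b)"
  have "((\<lambda>t::real. (t - 1/2) ^ b) has_integral (?F 1 - ?F (1/2))) {1/2..1}"
  proof (rule fundamental_theorem_of_calculus)
    fix t :: real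
    show "(?F has_vector_derivative (t - 1/2) ^ b) (at t within {1/2..1})"
      using DERIV_cdivide[OF DERIV_shifted_powers(1)[where a = "1/2" and b = b and t = t and S = "{1/2..1}"],
          where c = "real (Suc b)"]
      by (simp add: has_real_derivative_iff_has_vector_derivative[symmetric] del: of_nat_Suc power_Suc)
  qed simp
  moreover have "?F 1 - ?F (1/2) = (1/2) ^ (b + 0 + 1) * fact b * fact 0 / (fact (b + 0 + 1) :: real)"
    by simp
  ultimately show ?case by simp
next
  case (Suc c)
  define r where "r = real (Suc c) / real (Suc b)"
  \<comment> \<open>\<open>?F\<close> vanishes at both ends, so its derivative \<open>?f\<close> has
    integral 0.\<close>
  let ?F = "\<lambda>t::real. (t - 1/2) ^ Suc b * (1 - t) ^ Suc c / real (Suc b)"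
  let ?f = "\<lambda>t::real. (t - 1/2) ^ b * (1 - t) ^ Suc c - r * ((t - 1/2) ^ Suc b * (1 - t) ^ c)"
  have "(?f has_integral (?F 1 - ?F (1/2))) {1/2..1}"
  proof (rule fundamental_theorem_of_calculus)
    fix t :: real
    have "(?F has_real_derivative
        (real (Suc b) * (t - 1/2) ^ b * (1 - t) ^ Suc c
          + (- real (Suc c) * (1 - t) ^ c) * (t - 1/2) ^ Suc b) / real (Suc b)) (at t within {1/2..1})"
      by (intro DERIV_cdivide DERIV_mult DERIV_shifted_powers)
    also have "(real (Suc b) * (t - 1/2) ^ b * (1 - t) ^ Suc c
          + (- real (Suc c) * (1 - t) ^ c) * (t - 1/2) ^ Suc b) / real (Suc b) = ?f t"
      by (simp add: r_def diff_divide_distrib del: of_nat_Suc power_Suc)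
    finally show "(?F has_vector_derivative ?f t) (at t within {1/2..1})"
      by (simp add: has_real_derivative_iff_has_vector_derivative)
  qed simp
  then have "(?f has_integral 0) {1/2..1}" by simp
  from has_integral_add[OF this has_integral_mult_right[OF Suc[of "Suc b"], of r]]
  have int: "((\<lambda>t::real. (t - 1/2) ^ b * (1 - t) ^ Suc c) has_integral
      r * ((1/2) ^ (Suc b + c + 1) * fact (Suc b) * fact c / fact (Suc b + c + 1))) {1/2..1}"
    by simp
  have "r * ((1/2) ^ (Suc b + c + 1) * fact (Suc b) * fact c / fact (Suc b + c + 1))
      = (1/2) ^ (b + Suc c + 1) * fact b * fact (Suc c) / (fact (b + Suc c + 1) :: real)"
  proof -
    have "fact (Suc b) = real (Suc b) * fact b" "fact (Suc c) = real (Suc c) * fact c"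
      "Suc b + c + 1 = b + Suc c + 1"
      by simp_all
    then show ?thesis unfolding r_def by (simp del: fact_Suc of_nat_Suc power_Suc)
  qed
  then show ?case using int by (simp only:)
qed

text \<open>The integrand is the bound of \<open>accept_prob_at_time\<close> at
  \<open>q = 1 / (2 * t)\<close>. Multiplied out it is
  \<open>1 / (4 * t\<^sup>2) + (3 / 2 - t - 1 / (2 * t)) / 4\<close>, from which the antiderivative
  is read off.\<close>

lemma rate_integral:
  "((\<lambda>t::real. (1 / (2 * t))\<^sup>2 * (1 + (1 - 1 / (2 * t)) * (t\<^sup>2 * (1 - t))))
    has_integral (11/32 - ln 2 / 8)) {1/2..1}"
proof -
  let ?F = "\<lambda>t::real. - 1 / (4 * t) + (3 * t / 2 - t\<^sup>2 / 2 - ln t / 2) / 4"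
  have "((\<lambda>t::real. (1 / (2 * t))\<^sup>2 * (1 + (1 - 1 / (2 * t)) * (t\<^sup>2 * (1 - t)))) has_integral (?F 1 - ?F (1/2))) {1/2..1}"
  proof (rule fundamental_theorem_of_calculus)
    fix t :: real assume "t \<in> {1/2..1}"
    then have t: "t > 0" by simp
    have "(?F has_real_derivative (1 / (4 * t\<^sup>2) + (3 / 2 - t - 1 / (2 * t)) / 4)) (at t within {1/2..1})"
      using t by (auto intro!: derivative_eq_intros simp: field_simps power2_eq_square)
    moreover have "1 / (4 * t\<^sup>2) + (3 / 2 - t - 1 / (2 * t)) / 4 =
        (1 / (2 * t))\<^sup>2 * (1 + (1 - 1 / (2 * t)) * (t\<^sup>2 * (1 - t)))"
      using t by (simp add: field_simps power2_eq_square)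
    ultimately show "(?F has_vector_derivative (1 / (2 * t))\<^sup>2 * (1 + (1 - 1 / (2 * t)) * (t\<^sup>2 * (1 - t))))
        (at t within {1/2..1})"
      by (simp add: has_real_derivative_iff_has_vector_derivative)
  qed simp
  moreover have "?F 1 - ?F (1/2) = 11/32 - ln 2 / 8"
    by (simp add: ln_div power2_eq_square field_simps)
  ultimately show ?thesis by simp
qed

text \<open>Left: each element other than the tagged one independently arrives in the sample with
  probability \<open>1/2\<close>, between sample and tagged element with probability \<open>t - 1/2\<close>, and later with
  probability \<open>1 - t\<close>, given arrival time \<open>t\<close> of the tagged element.\<close>

lemma subset_expect_nested_integral:
  assumes Z: "finite Z"
  shows "((\<lambda>t. subset_expect t Z (\<lambda>X. subset_expect (1 / (2 * t)) X (\<lambda>A. G A (X - A)))) has_integral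
    (\<Sum>X\<in>Pow Z. \<Sum>A\<in>Pow X. (1/2) ^ Suc (card Z) * fact (card (X - A)) * fact (card (Z - X))
       / fact (Suc (card (Z - A))) * G A (X - A))) {1/2..1}"
proof -
  let ?g = "\<lambda>X A t::real. (1/2) ^ card A * G A (X - A) * ((t - 1/2) ^ card (X - A) * (1 - t) ^ card (Z - X))"
  have int: "((\<lambda>t. \<Sum>X\<in>Pow Z. \<Sum>A\<in>Pow X. ?g X A t) has_integral
     (\<Sum>X\<in>Pow Z. \<Sum>A\<in>Pow X. (1/2) ^ card A * G A (X - A) *
      ((1/2) ^ (card (X - A) + card (Z - X) + 1) * fact (card (X - A)) * fact (card (Z - X))
        / fact (card (X - A) + card (Z - X) + 1)))) {1/2..1}"
  proof (rule has_integral_sum, goal_cases)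
    case 1 show ?case using Z by simp
  next
    case (2 X)
    show ?case
    proof (rule has_integral_sum, goal_cases)
      case 1 show ?case using 2 finite_subset[OF _ Z] by simp
    next
      case 2 show ?case by (rule has_integral_mult_right[OF beta_integral])
    qed
  qed
  have diff: "card A + card (X - A) = card X" if "finite X" "A \<subseteq> X" for X A :: "'a set"
    using card_mono[OF that] card_Diff_subset[OF finite_subset[OF that(2,1)] that(2)] by linarith
  have card: "card A + (card (X - A) + card (Z - X)) = card Z" "card (X - A) + card (Z - X) = card (Z - A)"
    if XA: "X \<subseteq> Z" "A \<subseteq> X" for X A
    using diff[OF Z XA(1)] diff[OF finite_subset[OF XA(1) Z] XA(2)] diff[OF Z subset_trans[OF XA(2,1)]]
    by linarith+
  have eq1: "(1/2) ^ card A * G A (X - A) *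
      ((1/2) ^ (card (X - A) + card (Z - X) + 1) * fact (card (X - A)) * fact (card (Z - X))
        / fact (card (X - A) + card (Z - X) + 1)) =
      (1/2) ^ Suc (card Z) * fact (card (X - A)) * fact (card (Z - X)) / fact (Suc (card (Z - A))) * G A (X - A)"
    if "X \<subseteq> Z" "A \<subseteq> X" for X A
  proof -
    have "(1/2::real) ^ card A * (1/2) ^ (card (X - A) + card (Z - X) + 1) = (1/2) ^ Suc (card Z)"
      using card(1)[OF that] by (simp add: power_add[symmetric])
    moreover have "card (X - A) + card (Z - X) + 1 = Suc (card (Z - A))" using card(2)[OF that] by simp
    moreover have "p * g * (r * x * y / d) = (p * r) * x * y / d * g" for p g r x y d :: real by simp
    ultimately show ?thesis by (simp only:)
  qed
  have eq2: "subset_expect t Z (\<lambda>X. subset_expect (1 / (2 * t)) X (\<lambda>A. G A (X - A))) = (\<Sum>X\<in>Pow Z. \<Sum>A\<in>Pow X. ?g X A t)"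
    if t: "t \<in> {1/2..1}" for t
    unfolding subset_expect_def sum_distrib_left
  proof (intro sum.cong refl)
    fix X A assume X: "X \<in> Pow Z" and A: "A \<in> Pow X"
    have "finite X" "A \<subseteq> X" using X A finite_subset[OF _ Z] by auto
    then have cX: "card X = card A + card (X - A)" using diff by simp
    \<comment> \<open>The factors \<open>t\<close> of the arrivals cancel the denominators of the
      sampling probabilities, which leaves Beta integrands.\<close>
    have "t ^ card X * ((1 / (2 * t)) ^ card A * (1 - 1 / (2 * t)) ^ card (X - A))
        = (t * (1 / (2 * t))) ^ card A * (t * (1 - 1 / (2 * t))) ^ card (X - A)"
      unfolding cX power_add power_mult_distrib by simp
    moreover have "t * (1 / (2 * t)) = 1/2" "t * (1 - 1 / (2 * t)) = t - 1/2"
      using t by (auto simp: field_simps)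
    ultimately have "t ^ card X * ((1 / (2 * t)) ^ card A * (1 - 1 / (2 * t)) ^ card (X - A))
        = (1/2) ^ card A * (t - 1/2) ^ card (X - A)" by (simp only:)
    then have "(t ^ card X * ((1 / (2 * t)) ^ card A * (1 - 1 / (2 * t)) ^ card (X - A))) *
        ((1 - t) ^ card (Z - X) * G A (X - A)) = ?g X A t" by simp
    then show "t ^ card X * (1 - t) ^ card (Z - X) *
        ((1 / (2 * t)) ^ card A * (1 - 1 / (2 * t)) ^ card (X - A) * G A (X - A)) = ?g X A t"
      by (simp add: mult_ac)
  qed
  have "(\<Sum>X\<in>Pow Z. \<Sum>A\<in>Pow X. (1/2) ^ card A * G A (X - A) *
      ((1/2) ^ (card (X - A) + card (Z - X) + 1) * fact (card (X - A)) * fact (card (Z - X))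
        / fact (card (X - A) + card (Z - X) + 1))) =
    (\<Sum>X\<in>Pow Z. \<Sum>A\<in>Pow X. (1/2) ^ Suc (card Z) * fact (card (X - A)) * fact (card (Z - X))
       / fact (Suc (card (Z - A))) * G A (X - A))"
    by (intro sum.cong refl eq1) auto
  then show ?thesis
    using has_integral_eq[OF eq2[symmetric] int] by simp
qed

section \<open>From integrals to counting orders\<close>

text \<open>Orders with \<open>A\<close> first, then \<open>X - A\<close>, then \<open>e\<close>,
  then the rest are concatenations of three permutations around \<open>e\<close>. Each summand
  counts them for one pair, and different pairs give different orders.\<close>

lemma card_tagged_permutations:
  assumes E: "finite E" "e \<in> E"
  shows "(\<Sum>(X, A)\<in>{(X, A). A \<subseteq> X \<and> X \<subseteq> E - {e} \<and> card A = K \<and> Q A (X - A)}.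
      fact K * fact (card (X - A)) * fact (card (E - {e} - X)))
    \<le> card {ys \<in> permutations_of_set E. \<exists>n<length ys. K \<le> n \<and> ys ! n = e \<and>
        Q (set (take K ys)) (set (drop K (take n ys)))}" (is "?L \<le> card ?R")
proof -
  define Z where "Z = E - {e}"
  let ?P = "{(X, A). A \<subseteq> X \<and> X \<subseteq> Z \<and> card A = K \<and> Q A (X - A)}"
  let ?T = "\<lambda>(X, A). permutations_of_set A \<times> permutations_of_set (X - A) \<times> permutations_of_set (Z - X)"
  let ?f = "\<lambda>(p :: 'a set \<times> 'a set, (ya, yb, yc)). ya @ yb @ e # yc"
  have finO: "finite Z" using E by (simp add: Z_def)
  have fin: "finite X" "finite A" if "A \<subseteq> X" "X \<subseteq> Z" for X A
    using that finO by (auto intro: finite_subset)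
  have finP: "finite ?P"
    by (rule finite_subset[of _ "Pow Z \<times> Pow Z"]) (use finO in auto)
  have "?L = (\<Sum>p\<in>?P. card (?T p))"
    by (rule sum.cong) (auto simp: Z_def card_cartesian_product fin[unfolded Z_def] E mult_ac)
  also have "\<dots> = card (Sigma ?P ?T)"
    using finP fin finO by (subst card_SigmaI) (auto intro!: finite_cartesian_product)
  also have "\<dots> = card (?f ` Sigma ?P ?T)"
  proof (rule card_image[symmetric], rule inj_onI, clarsimp, goal_cases)
    case (1 X A ya yb yc X' A' ya' yb' yc')
    have len: "length ya = card A" "length ya' = card A'"
      using 1 by (auto dest: length_finite_permutations_of_set)
    have sets: "set ya = A" "set yb = X - A" "set ya' = A'" "set yb' = X' - A'" "set yc = Z - X"
      using 1 by (auto dest: permutations_of_setD)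
    \<comment> \<open>Both samples have size \<open>K\<close>, so the prefixes have equal
      length.\<close>
    have eq: "ya = ya' \<and> yb @ e # yc = yb' @ e # yc'"
      using 1 len by simp
    moreover have "e \<notin> set yb" "e \<notin> set yc" using sets 1 by (auto simp: Z_def)
    ultimately have "yb = yb' \<and> yc = yc'"
      using append_Cons_eq_iff[of e yb yc yb' yc'] by blast
    then show ?case using eq sets 1 by blast
  qed
  also have "\<dots> \<le> card ?R"
  proof (rule card_mono)
    show "finite ?R" using E by simp
    show "?f ` Sigma ?P ?T \<subseteq> ?R"
    proof (clarsimp, goal_cases)
      case (1 X A ya yb yc)
      have sets: "set ya = A" "set yb = X - A" "set yc = Z - X" "distinct ya" "distinct yb" "distinct yc"
        using 1 by (auto dest: permutations_of_setD)
      have len: "length ya = card A"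
        using 1 by (auto dest: length_finite_permutations_of_set)
      have "ya @ yb @ e # yc \<in> permutations_of_set E"
        using sets 1 E by (intro permutations_of_setI) (auto simp: Z_def)
      moreover have "length ya + length yb < length (ya @ yb @ e # yc)" "(ya @ yb @ e # yc) ! (length ya + length yb) = e"
        by (auto simp: nth_append)
      moreover have "set (take (card A) (ya @ yb @ e # yc)) = A"
        "set (drop (card A) (take (length ya + length yb) (ya @ yb @ e # yc))) = X - A"
        using len sets by auto
      ultimately show ?case using 1 len
        by (intro conjI exI[of _ "length ya + length yb"]) auto
    qed
  qed
  finally show ?thesis unfolding Z_def .
qed

text \<open>Independent uniform times give a uniform order with a binomial number of times below
  1/2. This is verified term by term: for each pair \<open>X\<close>, \<open>A\<close> the Beta
  integral is the binomial weight of \<open>K = card A\<close> times the fraction of orders of that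
  shape.\<close>

lemma accept_count_integral:
  fixes c :: real
  assumes E: "finite E" "e \<in> E"
    and at_time: "\<And>t. 1/2 \<le> t \<Longrightarrow> t \<le> 1 \<Longrightarrow> f t \<le> subset_expect t (E - {e}) (\<lambda>X. subset_expect (1 / (2 * t)) X (\<lambda>A. of_bool (Q A (X - A))))"
    and f: "(f has_integral c) {1/2..1}"
  shows "c \<le> (\<Sum>K\<le>card E. real (card E choose K) * (1/2) ^ card E / fact (card E) *
     card {ys \<in> permutations_of_set E. \<exists>n<length ys. K \<le> n \<and> ys ! n = e \<and>
        Q (set (take K ys)) (set (drop K (take n ys)))})"
proof -
  define Z where "Z = E - {e}"
  have Z: "finite Z" "Suc (card Z) = card E"
    using E card_Suc_Diff1[OF E] by (auto simp: Z_def)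
  let ?R = "\<lambda>K. card {ys \<in> permutations_of_set E. \<exists>n<length ys. K \<le> n \<and> ys ! n = e \<and>
        Q (set (take K ys)) (set (drop K (take n ys)))}"
  let ?h = "\<lambda>X A. (1/2) ^ Suc (card Z) * fact (card (X - A)) * fact (card (Z - X)) / fact (Suc (card (Z - A))) :: real"
  let ?D = "{(X, A). A \<subseteq> X \<and> X \<subseteq> Z \<and> Q A (X - A)}"
  have finD: "finite ?D"
    by (rule finite_subset[of _ "Pow Z \<times> Pow Z"]) (use Z in auto)
  have "c \<le> (\<Sum>X\<in>Pow Z. \<Sum>A\<in>Pow X. ?h X A * of_bool (Q A (X - A)))"
    by (rule has_integral_le[OF f subset_expect_nested_integral[OF Z(1)]]) (use at_time in \<open>auto simp: Z_def\<close>)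
  also have "\<dots> = (\<Sum>(X, A)\<in>Sigma (Pow Z) Pow. ?h X A * of_bool (Q A (X - A)))"
    by (rule sum.Sigma) (auto simp: Z(1) intro: finite_subset[OF _ Z(1)])
  also have "\<dots> = (\<Sum>(X, A)\<in>?D. ?h X A)"
  proof (rule sum.mono_neutral_cong_right)
    show "finite (Sigma (Pow Z) Pow)"
      by (rule finite_SigmaI) (auto simp: Z(1) intro: finite_subset[OF _ Z(1)])
  qed auto
  also have "\<dots> = (\<Sum>K\<le>card E. \<Sum>(X, A)\<in>{p \<in> ?D. card (snd p) = K}. ?h X A)"
  proof (rule sum.group[symmetric, OF finD])
    show "(\<lambda>p. card (snd p)) ` ?D \<subseteq> {..card E}"
    proof clarsimp
      fix X A assume "A \<subseteq> X" "X \<subseteq> Z"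
      then have "card A \<le> card Z" using Z by (intro card_mono) auto
      then show "card A \<le> card E" using Z by simp
    qed
  qed simp
  also have "\<dots> \<le> (\<Sum>K\<le>card E. real (card E choose K) * (1/2) ^ card E / fact (card E) * ?R K)"
  proof (rule sum_mono)
    fix K assume K: "K \<in> {..card E}"
    let ?DK = "{(X, A). A \<subseteq> X \<and> X \<subseteq> Z \<and> card A = K \<and> Q A (X - A)}"
    have "(\<Sum>(X, A)\<in>{p \<in> ?D. card (snd p) = K}. ?h X A) =
      (\<Sum>(X, A)\<in>?DK. real (card E choose K) * (1/2) ^ card E / fact (card E) *
        (fact K * fact (card (X - A)) * fact (card (Z - X))))"
    proof (rule sum.cong)
      fix p assume "p \<in> ?DK"
      then obtain X A where p: "p = (X, A)" "A \<subseteq> X" "X \<subseteq> Z" "card A = K" by auto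
      have A: "A \<subseteq> Z" using p by blast
      have "card (Z - A) = card Z - K" "K \<le> card Z"
        using card_Diff_subset[OF finite_subset[OF A Z(1)] A] card_mono[OF Z(1) A] p(4) by auto
      \<comment> \<open>The tagged element counts among the \<open>card E - K\<close> elements
        behind the sample.\<close>
      then have s: "Suc (card (Z - A)) = card E - K" using Z by simp
      have "real (card E choose K) = fact (card E) / (fact K * fact (card E - K))"
        using K by (intro binomial_fact) simp
      moreover have "f / (k * f') * h / f * (k * x * y) = h * x * y / f'"
        if "f \<noteq> 0" "k \<noteq> 0" for f k f' h x y :: real using that by simp
      ultimately show "(case p of (X, A) \<Rightarrow> ?h X A) = (case p of (X, A) \<Rightarrow>
          real (card E choose K) * (1/2) ^ card E / fact (card E) *
          (fact K * fact (card (X - A)) * fact (card (Z - X))))"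
        unfolding p(1) prod.case s Z(2) by (simp only: fact_nonzero not_False_eq_True)
    qed auto
    also have "\<dots> = real (card E choose K) * (1/2) ^ card E / fact (card E) *
        real (\<Sum>(X, A)\<in>?DK. fact K * fact (card (X - A)) * fact (card (Z - X)))"
      by (simp add: sum_distrib_left of_nat_sum case_prod_unfold of_nat_fact)
    also have "\<dots> \<le> real (card E choose K) * (1/2) ^ card E / fact (card E) * ?R K"
      using card_tagged_permutations[OF E, of K Q]
      by (intro mult_left_mono) (auto simp: Z_def simp del: of_nat_sum)
    finally show "(\<Sum>(X, A)\<in>{p \<in> ?D. card (snd p) = K}. ?h X A) \<le>
      real (card E choose K) * (1/2) ^ card E / fact (card E) * ?R K" .
  qed
  finally show ?thesis .
qed

section \<open>The online algorithm\<close>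

text \<open>The last component is a tie-breaking priority. Injective priorities make
  \<open>heavier\<close> total and keep parallel edges of equal weight apart in sets of
  items.\<close>

type_synonym item = "nat set \<times> real \<times> nat"

definition heavier :: "item \<Rightarrow> item \<Rightarrow> bool" where
  "heavier g h \<longleftrightarrow> fst (snd h) < fst (snd g) \<or> fst (snd h) = fst (snd g) \<and> snd (snd h) < snd (snd g)"

definition item :: "(nat \<Rightarrow> nat set) \<Rightarrow> (nat \<Rightarrow> real) \<Rightarrow> (nat \<Rightarrow> nat) \<Rightarrow> nat \<Rightarrow> item" where
  "item ends w \<tau> i = (ends i, w i, \<tau> i)"

definition label :: "(nat \<Rightarrow> nat) \<Rightarrow> (nat set \<times> real) list \<Rightarrow> item list" where
  "label \<pi> obs = map (\<lambda>k. (fst (obs ! k), snd (obs ! k), \<pi> k)) [0..<length obs]"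

text \<open>The first \<open>K\<close> arrivals are the sample and are all rejected by
  \<open>K < length ys\<close>; the current edge is the last entry.\<close>

definition strat :: "nat set \<Rightarrow> nat \<Rightarrow> (nat \<Rightarrow> nat) \<Rightarrow> strategy" where
  "strat V K \<pi> obs \<longleftrightarrow> (let ys = label \<pi> obs in K < length ys \<and>
     prim.accepts V fst heavier (set (take K ys)) (set (drop K (butlast ys))) (last ys))"

text \<open>The permutation \<open>\<pi>\<close> assigns tie-breaking priorities to arrival positions, which amounts to
  priorities of the edges that are independent of the arrival order.\<close>

definition sampling_algorithm :: algorithm where
  "sampling_algorithm V m = map_pmf (\<lambda>(K, \<pi>). strat V K \<pi>)
     (pair_pmf (binomial_pmf m (1/2)) (pmf_of_set {\<pi>. \<pi> permutes {0..<m}}))"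

text \<open>Being the identity beyond the list, this satisfies \<open>permutes\<close>. Composing
  edge priorities \<open>\<tau>\<close> with it gives the priorities of the arrival
  positions.\<close>

definition arrival_perm :: "nat list \<Rightarrow> nat \<Rightarrow> nat" where
  "arrival_perm xs k = (if k < length xs then xs ! k else k)"

lemma arrival_perm_permutes:
  assumes "xs \<in> permutations_of_set {0..<m}"
  shows "arrival_perm xs permutes {0..<m}"
proof -
  have xs: "set xs = {0..<m}" "distinct xs" using assms by (auto dest: permutations_of_setD)
  have len: "length xs = m" using distinct_card[OF xs(2)] xs(1) by simp
  have "bij_betw ((!) xs) {0..<m} {0..<m}"
    by (rule bij_betw_nth[OF xs(2)]) (simp_all add: xs(1) len atLeast0LessThan)
  moreover have "bij_betw (arrival_perm xs) {0..<m} {0..<m} \<longleftrightarrow> bij_betw ((!) xs) {0..<m} {0..<m}"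
    by (rule bij_betw_cong) (simp add: arrival_perm_def len)
  ultimately have "bij_betw (arrival_perm xs) {0..<m} {0..<m}" by simp
  then show ?thesis by (rule bij_imp_permutes) (simp add: arrival_perm_def len)
qed

lemma take_label: "take n (label \<pi> obs) = label \<pi> (take n obs)"
  by (rule nth_equalityI) (auto simp: label_def)

lemma length_label [simp]: "length (label \<pi> obs) = length obs"
  by (simp add: label_def)

lemma label_observations:
  assumes "\<And>k. k < length xs \<Longrightarrow> \<pi> k = \<tau> (xs ! k)"
  shows "label \<pi> (observations ends w xs) = map (item ends w \<tau>) xs"
  by (rule nth_equalityI) (use assms in \<open>auto simp: label_def observations_def item_def\<close>)

lemma strat_prefix:
  assumes "k < length obs"
  shows "strat V K \<pi> (take (Suc k) obs) \<longleftrightarrow> K \<le> k \<and>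
    prim.accepts V fst heavier (set (take K (label \<pi> obs))) (set (drop K (take k (label \<pi> obs)))) (label \<pi> obs ! k)"
proof -
  let ?ys = "label \<pi> obs"
  have k: "k < length ?ys" using assms by simp
  have 1: "label \<pi> (take (Suc k) obs) = take (Suc k) ?ys" by (simp add: take_label)
  have 2: "butlast (take (Suc k) ?ys) = take k ?ys" "last (take (Suc k) ?ys) = ?ys ! k"
    using k by (auto simp: take_Suc_conv_app_nth)
  have 3: "take K (take (Suc k) ?ys) = take K ?ys" if "K \<le> k" using that by (simp add: min_def)
  have 4: "length (take (Suc k) ?ys) = Suc k" using k by simp
  show ?thesis
    unfolding strat_def Let_def 1 2 4 using 3 by (auto simp: less_Suc_eq_le)
qed

lemma prim_items:
  assumes "graph_input V m ends w" "inj_on \<tau> {0..<m}"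
  shows "prim V (item ends w \<tau> ` {0..<m}) fst heavier"
proof
  fix g h assume "g \<in> item ends w \<tau> ` {0..<m}" "h \<in> item ends w \<tau> ` {0..<m}" "g \<noteq> h"
  then obtain i j where "i < m" "j < m" "g = item ends w \<tau> i" "h = item ends w \<tau> j"
    by (meson atLeastLessThan_iff imageE)
  moreover from this \<open>g \<noteq> h\<close> have "i \<noteq> j" by auto
  moreover from calculation have "\<tau> i \<noteq> \<tau> j" using assms(2) by (auto dest: inj_onD)
  ultimately show "heavier g h \<or> heavier h g" by (auto simp: heavier_def item_def)
next
  fix g assume "g \<in> item ends w \<tau> ` {0..<m}"
  then obtain i where "i < m" "g = item ends w \<tau> i" by auto
  then show "fst g \<subseteq> V" "card (fst g) = 2" using assms(1) by (simp_all add: graph_input_def item_def)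
qed (use assms(1) in \<open>auto simp: graph_input_def heavier_def\<close>)

section \<open>Feasibility\<close>

lemma accepted_iff:
  fixes ends :: "nat \<Rightarrow> nat set" and w :: "nat \<Rightarrow> real"
  assumes "\<And>k. k < length xs \<Longrightarrow> \<pi> k = \<tau> (xs ! k)"
  defines "ys \<equiv> map (item ends w \<tau>) xs"
  shows "i \<in> accepted (strat V K \<pi>) ends w xs \<longleftrightarrow>
    (\<exists>n<length xs. xs ! n = i \<and> K \<le> n \<and>
      prim.accepts V fst heavier (set (take K ys)) (set (drop K (take n ys))) (ys ! n))"
proof -
  have "label \<pi> (observations ends w xs) = ys"
    unfolding ys_def by (rule label_observations) (rule assms(1))
  moreover have "length (observations ends w xs) = length xs" by (simp add: observations_def)
  ultimately show ?thesis
    unfolding accepted_def using strat_prefix[of _ "observations ends w xs" V K \<pi>] by auto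
qed

text \<open>On a cycle of accepted edges take the vertex \<open>z\<close> that the run on the sample
  visits last. By \<open>hits_rank\<close> both cycle edges at \<open>z\<close> must have been
  accepted for hitting \<open>z\<close>, but the earlier one blocks \<open>z\<close> for the later
  one.\<close>

lemma accepted_acyclic:
  assumes G: "graph_input V m ends w" and xs: "xs \<in> permutations_of_set {0..<m}"
    and \<pi>: "\<pi> permutes {0..<m}"
  shows "acyclic_edges ends (accepted (strat V K \<pi>) ends w xs)"
  unfolding acyclic_edges_def
proof (rule notI, elim exE conjE)
  define \<sigma> where "\<sigma> = arrival_perm xs"
  define \<tau> where "\<tau> = \<pi> \<circ> inv \<sigma>"
  have \<sigma>: "\<sigma> permutes {0..<m}" unfolding \<sigma>_def by (rule arrival_perm_permutes[OF xs])
  have xsp: "set xs = {0..<m}" "distinct xs" using xs by (auto dest: permutations_of_setD)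
  have \<pi>\<tau>: "\<pi> k = \<tau> (xs ! k)" if "k < length xs" for k
  proof -
    have "xs ! k = \<sigma> k" using that by (simp add: \<sigma>_def arrival_perm_def)
    then show ?thesis using permutes_inverses(2)[OF \<sigma>] by (simp add: \<tau>_def)
  qed
  have inj: "inj_on \<tau> {0..<m}"
    unfolding \<tau>_def using permutes_compose[OF permutes_inv[OF \<sigma>] \<pi>] by (rule permutes_inj_on)
  interpret prim V "item ends w \<tau> ` {0..<m}" fst heavier by (rule prim_items[OF G inj])
  let ?f = "item ends w \<tau>"
  define ys where "ys = map ?f xs"
  define S where "S = set (take K ys)"
  have injf: "inj_on ?f {0..<m}" using inj by (auto simp: inj_on_def item_def)
  have dys: "distinct ys" "set ys = ?f ` {0..<m}"
    using xsp injf by (auto simp: ys_def distinct_map)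
  have len: "length ys = length xs" by (simp add: ys_def)
  have SE: "S \<subseteq> ?f ` {0..<m}" using set_take_subset[of K ys] dys(2) by (simp add: S_def)
  have acc: "\<exists>n<length xs. xs ! n = f \<and> K \<le> n \<and> accepts S (set (drop K (take n ys))) (ys ! n)"
    if "f \<in> accepted (strat V K \<pi>) ends w xs" for f
    using that accepted_iff[of xs \<pi> \<tau> f V K ends w, OF \<pi>\<tau>] unfolding S_def ys_def by simp
  fix es vs assume es: "set es \<subseteq> accepted (strat V K \<pi>) ends w xs" and cyc: "is_cycle ends es vs"
  define n where "n = length es"
  have c: "n \<ge> 1" "length vs = n" "distinct es" "distinct vs"
    "\<And>i. i < n \<Longrightarrow> ends (es ! i) = {vs ! i, vs ! ((i + 1) mod n)}"
    using cyc by (auto simp: is_cycle_def n_def)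
  have fin: "finite (set vs)" "set vs \<noteq> {}" using c by auto
  have "Max ((\<lambda>x. hit_step {x} S) ` set vs) \<in> (\<lambda>x. hit_step {x} S) ` set vs"
    using fin by (intro Max_in) auto
  then obtain z where "z \<in> set vs" "hit_step {z} S = Max ((\<lambda>x. hit_step {x} S) ` set vs)" by auto
  then have z: "z \<in> set vs" "\<And>x. x \<in> set vs \<Longrightarrow> hit_step {x} S \<le> hit_step {z} S"
    using fin by auto
  obtain j where j: "j < n" "vs ! j = z" using z(1) c(2) by (auto simp: in_set_conv_nth)
  \<comment> \<open>The cyclic predecessor of \<open>j\<close>; adding \<open>n\<close> first avoids
    truncated subtraction.\<close>
  define j' where "j' = (j + n - 1) mod n"
  have j': "j' < n" "(j' + 1) mod n = j"
  proof -
    show "j' < n" using c(1) by (simp add: j'_def)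
    have "(j' + 1) mod n = (j + n - 1 + 1) mod n" unfolding j'_def by (rule mod_add_left_eq)
    also have "\<dots> = j" using c(1) j(1) by simp
    finally show "(j' + 1) mod n = j" .
  qed
  have head: "\<exists>k<length xs. xs ! k = es ! i \<and> K \<le> k \<and> hits S (ys ! k) z \<and>
      (\<forall>h\<in>set (drop K (take k ys)). \<not> hits S h z)"
    if i: "i < n" and zi: "z \<in> ends (es ! i)" for i
  proof -
    have "es ! i \<in> accepted (strat V K \<pi>) ends w xs" using es i n_def by auto
    then obtain k where k: "k < length xs" "xs ! k = es ! i" "K \<le> k" "accepts S (set (drop K (take k ys))) (ys ! k)"
      using acc by blast
    then obtain v where v: "hits S (ys ! k) v" "\<forall>h\<in>set (drop K (take k ys)). \<not> hits S h v"
      by (auto simp: accepts_def)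
    have yk: "ys ! k = ?f (es ! i)" using k by (simp add: ys_def)
    have ykE: "ys ! k \<in> ?f ` {0..<m}" using nth_mem[of k ys] dys(2) k(1) len by simp
    have "ys ! k \<notin> S"
      unfolding S_def using dys(1) k len by (auto simp: in_set_conv_nth nth_eq_iff_index_eq)
    then obtain x where x: "fst (ys ! k) = {x, v}" "hit_step {x} S < hit_step {v} S"
      by (rule hits_rank[OF SE ykE _ v(1)])
    have "ends (es ! i) = {x, v}" using x yk by (simp add: item_def)
    moreover have "ends (es ! i) \<subseteq> set vs" using c(5)[OF i] c(1,2) i by auto
    ultimately have "z = v" using x(2) z(2)[of v] zi by auto
    then show ?thesis using k v by auto
  qed
  obtain k where k: "k < length xs" "xs ! k = es ! j" "K \<le> k" "hits S (ys ! k) z"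
    "\<forall>h\<in>set (drop K (take k ys)). \<not> hits S h z"
    using head[OF j(1)] c(5)[OF j(1)] j(2) by auto
  obtain k' where k': "k' < length xs" "xs ! k' = es ! j'" "K \<le> k'" "hits S (ys ! k') z"
    "\<forall>h\<in>set (drop K (take k' ys)). \<not> hits S h z"
    using head[OF j'(1)] c(5)[OF j'(1)] j'(2) j(2) by auto
  \<comment> \<open>A cycle of length one would be a loop. The contradiction takes two different
    cycle edges at \<open>z\<close>.\<close>
  have "n \<noteq> 1"
  proof
    assume "n = 1"
    then have "card (ends (es ! 0)) = 1" using c(5)[of 0] by simp
    moreover have "es ! 0 \<in> accepted (strat V K \<pi>) ends w xs" using c(1) n_def by (intro subsetD[OF es] nth_mem) linarith
    then obtain k where "k < length xs" "xs ! k = es ! 0" using acc by blast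
    then have "es ! 0 \<in> set xs" by (metis nth_mem)
    then have "card (ends (es ! 0)) = 2" using G xsp(1) by (auto simp: graph_input_def)
    ultimately show False by simp
  qed
  have "j \<noteq> j'"
  proof
    assume jj: "j = j'"
    show False
    proof (cases "j + 1 < n")
      case True then show False using j'(2) jj by simp
    next
      case False
      then have "j + 1 = n" using j(1) by simp
      then show False using j'(2) jj \<open>n \<noteq> 1\<close> by simp
    qed
  qed
  then have "es ! j \<noteq> es ! j'" using c(3) j j' n_def by (simp add: nth_eq_iff_index_eq)
  then have "k \<noteq> k'" using k k' by auto
  moreover have in_drop: "ys ! a \<in> set (drop K (take b ys))" if "K \<le> a" "a < b" "b < length xs" for a b
  proof -
    have "drop K (take b ys) ! (a - K) = ys ! a" "a - K < length (drop K (take b ys))"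
      using that len by auto
    then show ?thesis using nth_mem[of "a - K" "drop K (take b ys)"] by simp
  qed
  moreover have "k < k' \<or> k' < k" using \<open>k \<noteq> k'\<close> by auto
  ultimately show False using k k' in_drop[of k k'] in_drop[of k' k] by blast
qed

section \<open>The expected weight\<close>

text \<open>With the edge priorities \<open>\<tau>\<close> fixed, \<open>item\<close> is injective
  and carries orders of edge names bijectively to orders of items, where
  \<open>accept_count_integral\<close> applies.\<close>

lemma card_accepting_orders:
  assumes G: "graph_input V m ends w" and inj: "inj_on \<tau> {0..<m}" and i: "i < m"
    and max_forest: "item ends w \<tau> i \<in> prim.max_forest (item ends w \<tau> ` {0..<m}) fst heavier"
  shows "11/32 - ln 2 / 8 \<le> (\<Sum>K\<le>m. real (m choose K) * (1/2) ^ m / fact m *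
    card {xs \<in> permutations_of_set {0..<m}. i \<in> accepted (strat V K (\<tau> \<circ> arrival_perm xs)) ends w xs})"
proof -
  interpret prim V "item ends w \<tau> ` {0..<m}" fst heavier by (rule prim_items[OF G inj])
  let ?f = "item ends w \<tau>"
  let ?E = "?f ` {0..<m}"
  have injf: "inj_on ?f {0..<m}" using inj by (auto simp: inj_on_def item_def)
  have cE: "card ?E = m" using card_image[OF injf] by simp
  have iE: "?f i \<in> ?E" using i by simp
  have card: "card {ys \<in> permutations_of_set ?E. \<exists>n<length ys. K \<le> n \<and> ys ! n = ?f i \<and>
      accepts (set (take K ys)) (set (drop K (take n ys))) (?f i)} =
    card {xs \<in> permutations_of_set {0..<m}. i \<in> accepted (strat V K (\<tau> \<circ> arrival_perm xs)) ends w xs}"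
    (is "card ?A = card ?B") for K
  proof -
    have "?A = map ?f ` ?B"
    proof -
      have "(\<exists>n<length (map ?f xs). K \<le> n \<and> map ?f xs ! n = ?f i \<and>
          accepts (set (take K (map ?f xs))) (set (drop K (take n (map ?f xs)))) (?f i)) \<longleftrightarrow>
        i \<in> accepted (strat V K (\<tau> \<circ> arrival_perm xs)) ends w xs"
        if "xs \<in> permutations_of_set {0..<m}" for xs
      proof -
        have "?f (xs ! n) = ?f i \<longleftrightarrow> xs ! n = i" if "n < length xs" for n
          using injf i nth_mem[OF that] permutations_of_setD(1)[OF \<open>xs \<in> _\<close>] by (auto dest: inj_onD)
        then show ?thesis
          by (subst accepted_iff[where \<tau> = \<tau>]) (auto simp: arrival_perm_def)
      qed
      then show ?thesis unfolding permutations_of_set_image_inj[OF injf] by blast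
    qed
    moreover have "inj_on (map ?f) ?B"
    proof (rule inj_onI)
      fix xs ys assume "xs \<in> ?B" "ys \<in> ?B" and eq: "map ?f xs = map ?f ys"
      then have "set xs \<union> set ys = {0..<m}" using permutations_of_setD(1) by fastforce
      then show "xs = ys" by (intro map_inj_on[OF eq]) (simp add: injf)
    qed
    ultimately show ?thesis by (simp add: card_image)
  qed
  have "11/32 - ln 2 / 8 \<le> (\<Sum>K\<le>card ?E. real (card ?E choose K) * (1/2) ^ card ?E / fact (card ?E) *
    card {ys \<in> permutations_of_set ?E. \<exists>n<length ys. K \<le> n \<and> ys ! n = ?f i \<and>
      accepts (set (take K ys)) (set (drop K (take n ys))) (?f i)})"
  proof (rule accept_count_integral[OF finite_E iE _ rate_integral])
    fix t :: real assume t: "1/2 \<le> t" "t \<le> 1"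
    then show "(1 / (2 * t))\<^sup>2 * (1 + (1 - 1 / (2 * t)) * (t\<^sup>2 * (1 - t))) \<le>
        subset_expect t (?E - {?f i}) (\<lambda>X. subset_expect (1 / (2 * t)) X (\<lambda>A. of_bool (accepts A (X - A) (?f i))))"
      by (intro accept_prob_at_time[OF max_forest]) auto
  qed
  then show ?thesis unfolding cE card .
qed

lemma OPT_le_max_forest:
  assumes G: "graph_input V m ends w" and inj: "inj_on \<tau> {0..<m}"
  shows "OPT m ends w \<le> (\<Sum>i | i < m \<and> item ends w \<tau> i \<in> prim.max_forest (item ends w \<tau> ` {0..<m}) fst heavier. w i)"
proof -
  interpret prim V "item ends w \<tau> ` {0..<m}" fst heavier by (rule prim_items[OF G inj])
  let ?f = "item ends w \<tau>"
  have injf: "inj_on ?f {0..<m}" using inj by (auto simp: inj_on_def item_def)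
  have conn_f: "conn fst (?f ` S) x y \<Longrightarrow> conn ends S x y" for S x y
  proof -
    have "adj fst (?f ` S) = adj ends S" by (auto simp: adj_def item_def fun_eq_iff)
    then show "conn fst (?f ` S) x y \<Longrightarrow> conn ends S x y" by (simp add: conn_def)
  qed
  have le: "sum w F \<le> (\<Sum>i | i < m \<and> ?f i \<in> max_forest. w i)"
    if F: "F \<subseteq> {0..<m}" "acyclic_edges ends F" for F
  proof -
    have injF: "inj_on ?f F" using injf F(1) inj_on_subset by blast
    have "sum (\<lambda>g. fst (snd g)) (?f ` F) \<le> sum (\<lambda>g. fst (snd g)) max_forest"
    proof (rule max_forest_optimal)
      show "0 \<le> fst (snd g)" if "g \<in> ?f ` {0..<m}" for g
        using that G by (auto simp: graph_input_def item_def)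
      show "fst (snd h) \<le> fst (snd g)" if "heavier g h" for g h using that by (auto simp: heavier_def)
      show "?f ` F \<subseteq> ?f ` {0..<m}" using F by auto
      fix g x y assume g: "g \<in> ?f ` F" "fst g = {x, y}"
      then obtain f where f: "f \<in> F" "g = ?f f" "ends f = {x, y}" by (auto simp: item_def)
      have "card (ends f) = 2" using f(1) F(1) G by (auto simp: graph_input_def)
      then have "x \<noteq> y" using f(3) by auto
      then have "\<not> conn ends (F - {f}) x y" using acyclic_edges_not_conn[OF F(2) f(1,3)] by simp
      moreover have "?f ` F - {g} = ?f ` (F - {f})"
        using inj_on_image_set_diff[OF injF, of F "{f}"] f by auto
      ultimately show "\<not> conn fst (?f ` F - {g}) x y" using conn_f[of "F - {f}" x y] by auto
    qed
    moreover have "sum (\<lambda>g. fst (snd g)) (?f ` F) = sum w F"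
      using sum.reindex[OF injF, of "\<lambda>g. fst (snd g)"] by (simp add: item_def comp_def)
    moreover have "sum (\<lambda>g. fst (snd g)) max_forest = (\<Sum>i | i < m \<and> ?f i \<in> max_forest. w i)"
    proof -
      have "max_forest = ?f ` {i. i < m \<and> ?f i \<in> max_forest}" by (auto simp: max_forest_def)
      then have "sum (\<lambda>g. fst (snd g)) max_forest = sum (\<lambda>g. fst (snd g)) (?f ` {i. i < m \<and> ?f i \<in> max_forest})"
        by (rule arg_cong)
      also have "\<dots> = (\<Sum>i | i < m \<and> ?f i \<in> max_forest. fst (snd (?f i)))"
        by (subst sum.reindex) (auto intro: inj_on_subset[OF injf])
      finally show ?thesis by (simp add: item_def)
    qed
    ultimately show ?thesis by simp
  qed
  have "acyclic_edges ends {}" by (auto simp: acyclic_edges_def is_cycle_def)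
  then show ?thesis
    unfolding OPT_def using le by (intro Max.boundedI) auto
qed

lemma sum_accepted_weights:
  assumes X: "X \<subseteq> permutations_of_set {0..<m}"
  shows "(\<Sum>xs\<in>X. \<Sum>i\<in>accepted (S xs) ends w xs. w i)
    = (\<Sum>i<m. w i * card {xs \<in> X. i \<in> accepted (S xs) ends w xs})"
proof -
  let ?acc = "\<lambda>xs. accepted (S xs) ends w xs"
  have fin: "finite X" by (rule finite_subset[OF X]) simp
  have "(\<Sum>i\<in>?acc xs. w i) = (\<Sum>i<m. w i * of_bool (i \<in> ?acc xs))" if "xs \<in> X" for xs
  proof -
    have xs: "set xs = {0..<m}" using that X permutations_of_setD(1) by blast
    have "?acc xs \<subseteq> set xs" by (auto simp: accepted_def)
    then have "?acc xs \<subseteq> {..<m}" unfolding xs by auto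
    then show ?thesis by (intro sum.mono_neutral_cong_left) auto
  qed
  then have "(\<Sum>xs\<in>X. \<Sum>i\<in>?acc xs. w i) = (\<Sum>xs\<in>X. \<Sum>i<m. w i * of_bool (i \<in> ?acc xs))" by simp
  also have "\<dots> = (\<Sum>i<m. \<Sum>xs\<in>X. w i * of_bool (i \<in> ?acc xs))" by (rule sum.swap)
  also have "\<dots> = (\<Sum>i<m. w i * card {xs \<in> X. i \<in> ?acc xs})"
  proof (rule sum.cong[OF refl])
    fix i
    have "(\<Sum>xs\<in>X. of_bool (i \<in> ?acc xs)) = real (card {xs \<in> X. i \<in> ?acc xs})"
      using fin by (simp add: of_bool_def sum.If_cases Int_def)
    then show "(\<Sum>xs\<in>X. w i * of_bool (i \<in> ?acc xs)) = w i * card {xs \<in> X. i \<in> ?acc xs}"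
      by (simp only: sum_distrib_left[symmetric])
  qed
  finally show ?thesis .
qed

text \<open>Drawing position priorities independently of the order amounts to drawing edge
  priorities \<open>\<tau>\<close>. With \<open>\<tau>\<close> in the outer sum the maximum forest
  is fixed before the orders are averaged.\<close>

lemma expected_ALG_eq:
  "expected_ALG sampling_algorithm V m ends w = (\<Sum>\<tau> | \<tau> permutes {0..<m}. (\<Sum>i<m. w i *
     (\<Sum>K\<le>m. real (m choose K) * (1/2) ^ m / fact m *
       card {xs \<in> permutations_of_set {0..<m}. i \<in> accepted (strat V K (\<tau> \<circ> arrival_perm xs)) ends w xs}))) / fact m"
proof -
  define P where "P = {\<pi>. \<pi> permutes {0..<m}}"
  define X where "X = permutations_of_set {0..<m}"
  define W where "W K \<pi> xs = (\<Sum>i\<in>accepted (strat V K \<pi>) ends w xs. w i)" for K \<pi> xs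
  define a where "a K = real (m choose K) * (1/2) ^ m / fact m" for K
  define n where "n K \<tau> i = real (card {xs \<in> X. i \<in> accepted (strat V K (\<tau> \<circ> arrival_perm xs)) ends w xs})" for K \<tau> i
  have P: "finite P" "P \<noteq> {}" "card P = fact m"
  proof -
    show "finite P" unfolding P_def by (rule finite_permutations) simp
    show "P \<noteq> {}" using permutes_id[of "{0..<m}"] unfolding P_def by blast
    show "card P = fact m" unfolding P_def by (rule card_permutations) auto
  qed
  have X: "finite X" "X \<noteq> {}" "card X = fact m" by (auto simp: X_def)
  have "expected_ALG sampling_algorithm V m ends w =
      measure_pmf.expectation (pair_pmf (binomial_pmf m (1/2)) (pmf_of_set P))
        (\<lambda>(K, \<pi>). (\<Sum>xs\<in>X. W K \<pi> xs) / fact m)"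
    unfolding expected_ALG_def sampling_algorithm_def P_def[symmetric] X_def[symmetric] using X
    by (simp add: integral_map_pmf case_prod_unfold integral_pmf_of_set W_def)
  also have "\<dots> = (\<Sum>p\<in>{..m} \<times> P. pmf (pair_pmf (binomial_pmf m (1/2)) (pmf_of_set P)) p *\<^sub>R
      (case p of (K, \<pi>) \<Rightarrow> (\<Sum>xs\<in>X. W K \<pi> xs) / fact m))"
    by (rule integral_measure_pmf) (use P in auto)
  also have "\<dots> = (\<Sum>(K, \<pi>)\<in>{..m} \<times> P. a K * (\<Sum>xs\<in>X. W K \<pi> xs) / fact m)"
  proof (rule sum.cong)
    fix p assume "p \<in> {..m} \<times> P"
    then obtain K \<pi> where p: "p = (K, \<pi>)" "K \<le> m" "\<pi> \<in> P" by auto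
    have "(1/2::real) ^ K * (1/2) ^ (m - K) = (1/2) ^ m" using p(2) by (simp add: power_add[symmetric])
    then show "pmf (pair_pmf (binomial_pmf m (1/2)) (pmf_of_set P)) p *\<^sub>R
        (case p of (K, \<pi>) \<Rightarrow> (\<Sum>xs\<in>X. W K \<pi> xs) / fact m) =
      (case p of (K, \<pi>) \<Rightarrow> a K * (\<Sum>xs\<in>X. W K \<pi> xs) / fact m)"
      using p P by (simp add: pmf_pair mult.assoc a_def)
  qed simp
  also have "\<dots> = (\<Sum>K\<le>m. a K * (\<Sum>\<pi>\<in>P. \<Sum>xs\<in>X. W K \<pi> xs)) / fact m"
    by (simp add: sum.cartesian_product[symmetric] sum_distrib_left sum_divide_distrib)
  also have "(\<Sum>K\<le>m. a K * (\<Sum>\<pi>\<in>P. \<Sum>xs\<in>X. W K \<pi> xs)) = (\<Sum>K\<le>m. a K * (\<Sum>\<tau>\<in>P. \<Sum>i<m. w i * n K \<tau> i))"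
  proof (rule sum.cong[OF refl])
    fix K
    have "(\<Sum>\<pi>\<in>P. \<Sum>xs\<in>X. W K \<pi> xs) = (\<Sum>xs\<in>X. \<Sum>\<pi>\<in>P. W K \<pi> xs)" by (rule sum.swap)
    \<comment> \<open>Substitution \<open>\<pi> = \<tau> \<circ> arrival_perm xs\<close>, a
      bijection of \<open>P\<close> for each \<open>xs\<close>.\<close>
    also have "\<dots> = (\<Sum>xs\<in>X. \<Sum>\<tau>\<in>P. W K (\<tau> \<circ> arrival_perm xs) xs)"
      unfolding P_def X_def
      by (intro sum.cong refl sum_permutations_compose_right arrival_perm_permutes)
    also have "\<dots> = (\<Sum>\<tau>\<in>P. \<Sum>xs\<in>X. W K (\<tau> \<circ> arrival_perm xs) xs)" by (rule sum.swap)
    also have "\<dots> = (\<Sum>\<tau>\<in>P. \<Sum>i<m. w i * n K \<tau> i)"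
      unfolding W_def n_def by (intro sum.cong refl sum_accepted_weights) (simp add: X_def)
    finally show "a K * (\<Sum>\<pi>\<in>P. \<Sum>xs\<in>X. W K \<pi> xs) = a K * (\<Sum>\<tau>\<in>P. \<Sum>i<m. w i * n K \<tau> i)" by simp
  qed
  also have "\<dots> = (\<Sum>K\<le>m. \<Sum>\<tau>\<in>P. a K * (\<Sum>i<m. w i * n K \<tau> i))"
    by (simp only: sum_distrib_left)
  also have "\<dots> = (\<Sum>\<tau>\<in>P. \<Sum>K\<le>m. a K * (\<Sum>i<m. w i * n K \<tau> i))" by (rule sum.swap)
  also have "\<dots> = (\<Sum>\<tau>\<in>P. \<Sum>i<m. w i * (\<Sum>K\<le>m. a K * n K \<tau> i))"
  proof (rule sum.cong[OF refl])
    fix \<tau>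
    have "(\<Sum>K\<le>m. a K * (\<Sum>i<m. w i * n K \<tau> i)) = (\<Sum>K\<le>m. \<Sum>i<m. w i * (a K * n K \<tau> i))"
      by (simp add: sum_distrib_left mult.left_commute)
    also have "\<dots> = (\<Sum>i<m. \<Sum>K\<le>m. w i * (a K * n K \<tau> i))" by (rule sum.swap)
    finally show "(\<Sum>K\<le>m. a K * (\<Sum>i<m. w i * n K \<tau> i)) = (\<Sum>i<m. w i * (\<Sum>K\<le>m. a K * n K \<tau> i))"
      by (simp only: sum_distrib_left)
  qed
  finally show ?thesis unfolding P_def X_def a_def n_def .
qed

theorem theorem1:
  shows "\<exists>alg::algorithm. feasible alg \<and>
    (\<forall>V m ends w. graph_input V m ends w \<longrightarrow>
       OPT m ends w \<le> 3.95 * expected_ALG alg V m ends w)"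
proof (intro exI[of _ sampling_algorithm] conjI allI impI)
  show "feasible sampling_algorithm"
    unfolding feasible_def
  proof (intro allI impI ballI)
    fix V m ends w s xs
    assume G: "graph_input V m ends w" and s: "s \<in> set_pmf (sampling_algorithm V m)"
      and xs: "xs \<in> permutations_of_set {0..<m}"
    have "{\<pi>. \<pi> permutes {0..<m}} \<noteq> {}" using permutes_id[of "{0..<m}"] by blast
    then have "set_pmf (pmf_of_set {\<pi>. \<pi> permutes {0..<m}}) = {\<pi>. \<pi> permutes {0..<m}}"
      by (rule set_pmf_of_set) (simp add: finite_permutations)
    then obtain K \<pi> where "s = strat V K \<pi>" "\<pi> permutes {0..<m}"
      using s by (auto simp: sampling_algorithm_def)
    then show "acyclic_edges ends (accepted s ends w xs)"
      using accepted_acyclic[OF G xs] by simp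
  qed
next
  fix V m ends w assume G: "graph_input V m ends w"
  define c where "c = 11/32 - ln 2 / (8::real)"
  let ?P = "{\<tau>. \<tau> permutes {0..<m}}"
  let ?p = "\<lambda>\<tau> i. \<Sum>K\<le>m. real (m choose K) * (1/2) ^ m / fact m *
    card {xs \<in> permutations_of_set {0..<m}. i \<in> accepted (strat V K (\<tau> \<circ> arrival_perm xs)) ends w xs}"
  have w: "0 \<le> w i" if "i < m" for i using G that by (auto simp: graph_input_def)
  \<comment> \<open>From \<open>ln 2 \<le> 25/36\<close> follows \<open>c \<ge> 37/144\<close>, and
    \<open>3.95 * 37/144\<close> exceeds 1.\<close>
  have c: "0 \<le> c" "1 \<le> 3.95 * c" using ln2_le_25_over_36 by (auto simp: c_def)
  have "c * OPT m ends w \<le> (\<Sum>i<m. w i * ?p \<tau> i)" if \<tau>: "\<tau> \<in> ?P" for \<tau>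
  proof -
    have inj: "inj_on \<tau> {0..<m}" using \<tau> by (auto intro: permutes_inj_on)
    let ?M = "{i. i < m \<and> item ends w \<tau> i \<in> prim.max_forest (item ends w \<tau> ` {0..<m}) fst heavier}"
    have "c * OPT m ends w \<le> c * (\<Sum>i\<in>?M. w i)"
      by (rule mult_left_mono[OF OPT_le_max_forest[OF G inj] c(1)])
    also have "\<dots> = (\<Sum>i\<in>?M. w i * c)" by (simp add: sum_distrib_left mult.commute)
    also have "\<dots> \<le> (\<Sum>i\<in>?M. w i * ?p \<tau> i)"
      using card_accepting_orders[OF G inj] w unfolding c_def
      by (intro sum_mono mult_left_mono) auto
    also have "\<dots> \<le> (\<Sum>i<m. w i * ?p \<tau> i)"
      using w by (intro sum_mono2 mult_nonneg_nonneg sum_nonneg) auto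
    finally show ?thesis .
  qed
  then have "(\<Sum>\<tau>\<in>?P. c * OPT m ends w) \<le> (\<Sum>\<tau>\<in>?P. \<Sum>i<m. w i * ?p \<tau> i)" by (rule sum_mono)
  then have "fact m * (c * OPT m ends w) \<le> (\<Sum>\<tau>\<in>?P. \<Sum>i<m. w i * ?p \<tau> i)"
    using card_permutations[of "{0..<m}" m] by simp
  then have E: "c * OPT m ends w \<le> expected_ALG sampling_algorithm V m ends w"
    unfolding expected_ALG_eq by (simp add: field_simps)
  \<comment> \<open>Enlarging the factor 1 to \<open>3.95 * c\<close> needs a nonnegative optimum,
    which the empty forest provides.\<close>
  have "0 \<le> OPT m ends w"
  proof -
    have "acyclic_edges ends {}" by (auto simp: acyclic_edges_def is_cycle_def)
    then show ?thesis unfolding OPT_def by (intro Max_ge) (auto intro!: image_eqI[of _ _ "{}"])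
  qed
  then have "OPT m ends w \<le> 3.95 * c * OPT m ends w"
    using mult_right_mono[OF c(2)] by simp
  also have "\<dots> \<le> 3.95 * expected_ALG sampling_algorithm V m ends w" using E by simp
  finally show "OPT m ends w \<le> 3.95 * expected_ALG sampling_algorithm V m ends w" .
qed

end
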